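(* Assume the deletion probability is a constant $p\in(0,1)$. There exist (explicit) distinct strings $\mathbf{x},\mathbf{y}\in\{0,1\}^n$ within edit distance $4$ of each other such that any mean-based algorithm requires $\exp(\Omega(\log^2 n))$ traces to distinguish between $\mathbf{x}$ and $\mathbf{y}$ with high probability.
   Context: Strings are indexed from $0$: $\mathbf{x}=x_0x_1\cdots x_{n-1}$. The edit distance between two strings is the minimum number of insertions and deletions (of single bits) that transform one into the other. "Explicit" is meant informally: the support set of the strings can be described mathematically, by algebraic equations. A trace $\tilde{\mathbf{x}}$ of $\mathbf{x}$ is the random subsequence obtained by deleting each bit of $\mathbf{x}$ independently with probability $p$, with the convention $\tilde x_j=0$ for $j>|\tilde{\mathbf{x}}|-1$. For $j=0,\dots,n-1$ let $E_j(\mathbf{x})=\mathbb{E}[\tilde x_j]$. Distinguishing $\mathbf{x}$ and $\mathbf{y}$: given the strings $\mathbf{x},\mathbf{y}$ and a set $S$ of independent traces of one of them, the algorithm must output which string is the source. An algorithm is mean-based if its output depends only on the statistical estimates of the means $E_j$, $j=0,\dots,n-1$, of the source; that is, it disregards the actual samples and uses only the empirical averages $\mathbb{E}_S[\tilde x_j]$ of each bit over the sample set $S$ of independent traces. The number of traces is $|S|$. "With high probability" means with probability at least $2/3$. The asymptotic notation is as $n\to\infty$, with $p$ constant. *)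

theory Defs
  imports "HOL-Probability.Probability"
begin

type_synonym bits = "bool list"

inductive edit_step :: "bits \<Rightarrow> bits \<Rightarrow> bool" where
  deletion: "edit_step (u @ b # v) (u @ v)"
| insertion: "edit_step (u @ v) (u @ b # v)"

definition edit_distance :: "bits \<Rightarrow> bits \<Rightarrow> nat" where
  "edit_distance x y = (LEAST k. (edit_step ^^ k) x y)"

text \<open>The minimum in \<^const>\<open>edit_distance\<close> is attained.\<close>

lemma edit_distance_attained: "(edit_step ^^ edit_distance x y) x y"
proof -
  have del: "(edit_step ^^ length z) z []" for z
  proof (induction z)
    case (Cons b z)
    have "edit_step (b # z) z" using deletion[of "[]" b z] by simp
    from relpowp_Suc_I2[of edit_step, OF this Cons] show ?case by simp
  qed simp
  have ins: "(edit_step ^^ length z) [] z" for z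
  proof (induction z)
    case (Cons b z)
    have "edit_step z (b # z)" using insertion[of "[]" z b] by simp
    with Cons show ?case by auto
  qed simp
  have "(edit_step ^^ (length x + length y)) x y"
    using del[of x] ins[of y] by (auto simp: relpowp_add)
  then show ?thesis unfolding edit_distance_def by (rule LeastI)
qed

text \<open>The distribution of a trace: each bit is deleted independently with probability \<open>p\<close>.\<close>

primrec trace_pmf :: "real \<Rightarrow> bits \<Rightarrow> bits pmf" where
  "trace_pmf p [] = return_pmf []"
| "trace_pmf p (b # x) =
     do {
       deleted \<leftarrow> bernoulli_pmf p;
       t \<leftarrow> trace_pmf p x;
       return_pmf (if deleted then t else b # t)
     }"

definition trace_bit :: "bits \<Rightarrow> nat \<Rightarrow> real" where
  "trace_bit t j = (if j < length t \<and> t ! j then 1 else 0)"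

text \<open>A sample of traces is represented as a list, so that equal traces are counted with
  multiplicity.\<close>

definition empirical_mean :: "bits list \<Rightarrow> nat \<Rightarrow> real" where
  "empirical_mean S j = (\<Sum>t\<leftarrow>S. trace_bit t j) / real (length S)"

definition empirical_means :: "nat \<Rightarrow> bits list \<Rightarrow> real list" where
  "empirical_means n S = map (empirical_mean S) [0..<n]"

text \<open>A distinguisher receives the two candidate strings and a sample of traces, and names one
  of the candidates as the source. It may use internal randomness; a deterministic distinguisher
  returns point distributions.\<close>

type_synonym distinguisher = "bits \<Rightarrow> bits \<Rightarrow> bits list \<Rightarrow> bits pmf"

definition mean_based :: "distinguisher \<Rightarrow> bool" where
  "mean_based A \<longleftrightarrow>
     (\<forall>x y S S'. length x = length y \<and>
        empirical_means (length x) S = empirical_means (length x) S' \<longrightarrow> A x y S = A x y S')"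

definition success_prob :: "real \<Rightarrow> distinguisher \<Rightarrow> nat \<Rightarrow> bits \<Rightarrow> bits \<Rightarrow> bits \<Rightarrow> real" where
  "success_prob p A T x y src = pmf (replicate_pmf T (trace_pmf p src) \<bind> A x y) src"

definition distinguishes :: "real \<Rightarrow> distinguisher \<Rightarrow> nat \<Rightarrow> bits \<Rightarrow> bits \<Rightarrow> bool" where
  "distinguishes p A T x y \<longleftrightarrow>
     success_prob p A T x y x \<ge> 2 / 3 \<and> success_prob p A T x y y \<ge> 2 / 3"

end

theory Submission
  imports Defs "HOL-Real_Asymp.Real_Asymp"
begin

text \<open>
  Let \<open>alternating k\<close> be the word \<open>1010...\<close> of length \<open>k\<close>, and let \<open>B\<close> be \<open>alternating N\<close> with some bits
  flipped in such a way that the difference of the two indicator polynomials is a shifted copy of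
  \<open>(1 - w) (1 - w ^ 3) \<dots> (1 - w ^ 3 ^ (m - 1))\<close>, with \<open>m\<close> of order \<open>log n\<close> and \<open>N\<close> a small power of
  \<open>n\<close>. The two hard strings are \<open>alternating a @ 10 @ B @ alternating b\<close> and
  \<open>alternating a @ B @ 10 @ alternating b\<close>.

  A mean-based algorithm sees only the sum of \<open>T\<close> independent trace vectors, so we have to bound the
  total variation distance of the \<open>T\<close>-fold convolutions of the two trace distributions; we do this
  dually, on bounded test functions. Replacing the \<open>T\<close> factors one by one leaves the difference of
  the two trace distributions applied to a function that was already convolved with about \<open>T / 2\<close> (or
  more) traces of the same string. Such a function is smooth: whenever exactly one bit of a pair \<open>10\<close>
  survives, it is a fair coin flip, so that second differences are \<open>O(1 / T)\<close>.

  If \<open>B\<close> is replaced by \<open>alternating N\<close>, both strings become \<open>alternating n\<close>. So only the effect of the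
  flips matters. Expand it around the zero word in place of \<open>B\<close>. The linear part is tiny, since the
  polynomial above vanishes to order \<open>m\<close> at \<open>1\<close> and binomial distributions are smooth: this gives
  \<open>exp (- m\<^sup>2)\<close>. The remainder is \<open>O(N\<^sup>2 / T)\<close>, and moving \<open>10\<close> across \<open>B\<close> changes it only by a
  factor \<open>O(n powr (- 1 / 2))\<close>, since the trace of \<open>(10) ^ h\<close> is a product of binomially many independent
  words. Altogether the distance is \<open>O(T exp (- m\<^sup>2) + N\<^sup>2 / sqrt n)\<close>.\<close>

section \<open>Averaging operators and binomial smoothing\<close>

definition bounded_op :: "real \<Rightarrow> (('a \<Rightarrow> real) \<Rightarrow> 'b \<Rightarrow> real) \<Rightarrow> bool" where
  "bounded_op w S \<longleftrightarrow>
     (\<forall>c d F G. S (\<lambda>z. c * F z + d * G z) = (\<lambda>z. c * S F z + d * S G z)) \<and>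
     (\<forall>F M. (\<forall>z. \<bar>F z\<bar> \<le> M) \<longrightarrow> (\<forall>z. \<bar>S F z\<bar> \<le> w * M))"

definition mix_op :: "real \<Rightarrow> (('a \<Rightarrow> real) \<Rightarrow> 'a \<Rightarrow> real) \<Rightarrow> ('a \<Rightarrow> real) \<Rightarrow> 'a \<Rightarrow> real" where
  "mix_op r S F = (\<lambda>z. (1 - r) * F z + r * S F z)"

lemma bounded_opI:
  assumes "\<And>c d F G z. S (\<lambda>z. c * F z + d * G z) z = c * S F z + d * S G z"
    and "\<And>F M z. (\<And>z. \<bar>F z\<bar> \<le> M) \<Longrightarrow> \<bar>S F z\<bar> \<le> w * M"
  shows "bounded_op w S"
  using assms unfolding bounded_op_def by (auto simp: fun_eq_iff)

lemma bounded_op_linear: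
  "bounded_op w S \<Longrightarrow> S (\<lambda>z. c * F z + d * G z) = (\<lambda>z. c * S F z + d * S G z)"
  unfolding bounded_op_def by blast

lemma bounded_op_le: "bounded_op w S \<Longrightarrow> (\<And>z. \<bar>F z\<bar> \<le> M) \<Longrightarrow> \<bar>S F z\<bar> \<le> w * M"
  unfolding bounded_op_def by blast

lemma bounded_op_le1: "bounded_op 1 S \<Longrightarrow> (\<And>z. \<bar>F z\<bar> \<le> M) \<Longrightarrow> \<bar>S F z\<bar> \<le> M"
  using bounded_op_le[of 1 S F M z] by simp

lemma bounded_op_diff:
  assumes "bounded_op w S" shows "S (\<lambda>z. F z - G z) z = S F z - S G z"
  using bounded_op_linear[OF assms, of 1 F "-1" G] by (simp add: fun_eq_iff)

lemma bounded_op_nonneg: "bounded_op w S \<Longrightarrow> 0 \<le> w"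
  using bounded_op_le[of w S "\<lambda>_. 0" 1] by fastforce

lemma bounded_op_id: "bounded_op 1 (\<lambda>F. F)"
  by (rule bounded_opI) auto

lemma bounded_op_point: "bounded_op 1 (\<lambda>F z. F (f z))"
  by (rule bounded_opI) auto

lemma bounded_op_plus:
  assumes "bounded_op v R" "bounded_op w S"
  shows "bounded_op (v + w) (\<lambda>F z. R F z + S F z)"
proof (rule bounded_opI)
  fix F :: "'a \<Rightarrow> real" and M z assume "\<And>z. \<bar>F z\<bar> \<le> M"
  then have "\<bar>R F z\<bar> \<le> v * M" "\<bar>S F z\<bar> \<le> w * M"
    using bounded_op_le[OF assms(1)] bounded_op_le[OF assms(2)] by blast+
  then show "\<bar>R F z + S F z\<bar> \<le> (v + w) * M"
    by (simp add: algebra_simps)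
qed (simp add: bounded_op_linear[OF assms(1)] bounded_op_linear[OF assms(2)] algebra_simps)

lemma bounded_op_scale:
  assumes "bounded_op w S" "0 \<le> r"
  shows "bounded_op (r * w) (\<lambda>F z. r * S F z)"
proof (rule bounded_opI)
  fix F :: "'a \<Rightarrow> real" and M z assume "\<And>z. \<bar>F z\<bar> \<le> M"
  then have "\<bar>S F z\<bar> \<le> w * M"
    using bounded_op_le[OF assms(1)] by blast
  then show "\<bar>r * S F z\<bar> \<le> r * w * M"
    using assms(2) by (simp add: abs_mult mult.assoc mult_left_mono)
qed (simp add: bounded_op_linear[OF assms(1)] algebra_simps)

lemma bounded_op_comp:
  assumes "bounded_op v R" "bounded_op w S"
  shows "bounded_op (v * w) (\<lambda>F. R (S F))"
proof (rule bounded_opI)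
  fix F :: "'c \<Rightarrow> real" and M z assume "\<And>z. \<bar>F z\<bar> \<le> M"
  then have "\<bar>S F z\<bar> \<le> w * M" for z
    using bounded_op_le[OF assms(2)] by blast
  then show "\<bar>R (S F) z\<bar> \<le> v * w * M"
    using bounded_op_le[OF assms(1)] by (simp add: mult.assoc)
qed (simp add: bounded_op_linear[OF assms(1)] bounded_op_linear[OF assms(2)])

lemma bounded_op_comp1: "bounded_op 1 R \<Longrightarrow> bounded_op 1 S \<Longrightarrow> bounded_op 1 (\<lambda>F. R (S F))"
  using bounded_op_comp[of 1 R 1 S] by simp

lemma bounded_op_funpow:
  fixes S :: "('a \<Rightarrow> real) \<Rightarrow> 'a \<Rightarrow> real"
  assumes "bounded_op 1 S" shows "bounded_op 1 (S ^^ k)"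
proof (induction k)
  case 0 show ?case using bounded_op_id by (simp add: id_def)
next
  case (Suc k) then show ?case using bounded_op_comp1[OF assms Suc] by (simp add: comp_def)
qed

lemma bounded_op_mix:
  assumes "bounded_op 1 S" "0 \<le> r" "r \<le> 1" shows "bounded_op 1 (mix_op r S)"
  using bounded_op_plus[OF bounded_op_scale[OF bounded_op_id, of "1 - r"] bounded_op_scale[OF assms(1,2)]] assms
  by (simp add: mix_op_def[abs_def])

lemma Bernstein_eq_0: "n < k \<Longrightarrow> Bernstein n k x = 0"
  by (simp add: Bernstein_def)

lemma Bernstein_Suc_0: "Bernstein (Suc n) 0 x = (1 - x) * Bernstein n 0 x"
  by (simp add: Bernstein_def)

lemma Bernstein_Suc_Suc:
  "Bernstein (Suc n) (Suc k) x = (1 - x) * Bernstein n (Suc k) x + x * Bernstein n k x"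
proof (cases "Suc k \<le> n")
  case True
  then have "n - k = Suc (n - Suc k)" by simp
  then show ?thesis by (simp add: Bernstein_def algebra_simps)
next
  case False
  then have "k = n \<or> n < k" by linarith
  then show ?thesis by (auto simp: Bernstein_def binomial_eq_0)
qed

lemma sum_Bernstein_Suc:
  "(\<Sum>j\<le>Suc h. Bernstein (Suc h) j r * a j) =
     (1 - r) * (\<Sum>j\<le>h. Bernstein h j r * a j) + r * (\<Sum>j\<le>h. Bernstein h j r * a (Suc j))"
proof -
  have "(\<Sum>j\<le>Suc h. Bernstein (Suc h) j r * a j) =
      (1 - r) * (Bernstein h 0 r * a 0 + (\<Sum>j\<le>h. Bernstein h (Suc j) r * a (Suc j))) +
      r * (\<Sum>j\<le>h. Bernstein h j r * a (Suc j))"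
    by (simp only: sum.atMost_Suc_shift[of _ h] Bernstein_Suc_0 Bernstein_Suc_Suc sum_distrib_left
        distrib_right distrib_left sum.distrib mult.assoc add.assoc)
  also have "Bernstein h 0 r * a 0 + (\<Sum>j\<le>h. Bernstein h (Suc j) r * a (Suc j)) =
      (\<Sum>j\<le>Suc h. Bernstein h j r * a j)"
    by (simp only: sum.atMost_Suc_shift[of _ h])
  also have "\<dots> = (\<Sum>j\<le>h. Bernstein h j r * a j)"
    by (simp add: Bernstein_eq_0)
  finally show ?thesis .
qed

lemma mix_op_funpow:
  assumes "bounded_op 1 S"
  shows "(mix_op r S ^^ h) F z = (\<Sum>j\<le>h. Bernstein h j r * (S ^^ j) F z)"
proof (induction h arbitrary: F)
  case (Suc h)
  have S: "(S ^^ j) (mix_op r S F) z = (1 - r) * (S ^^ j) F z + r * (S ^^ Suc j) F z" for j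
    unfolding mix_op_def
    using bounded_op_linear[OF bounded_op_funpow[OF assms]] by (simp add: funpow_swap1)
  have "(mix_op r S ^^ Suc h) F z = (mix_op r S ^^ h) (mix_op r S F) z"
    by (simp only: funpow_Suc_right comp_def)
  also have "\<dots> = (\<Sum>j\<le>Suc h. Bernstein (Suc h) j r * (S ^^ j) F z)"
    by (subst Suc, subst sum_Bernstein_Suc, subst S)
      (simp only: distrib_left sum.distrib sum_distrib_left mult.left_commute)
  finally show ?case .
qed (simp add: Bernstein_def)

lemma Bernstein_variance: "(\<Sum>j\<le>n. Bernstein n j x * (real j - real n * x)\<^sup>2) = real n * x * (1 - x)"
proof -
  have *: "Bernstein n j x * (real j - real n * x)\<^sup>2 =
      real j * (real j - 1) * Bernstein n j x + (1 - 2 * (real n * x)) * (real j * Bernstein n j x)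
      + (real n * x)\<^sup>2 * Bernstein n j x" for j
    by (simp add: algebra_simps power2_eq_square)
  show ?thesis
    unfolding * sum.distrib sum_distrib_left[symmetric] sum_k_Bernstein sum_kk_Bernstein sum_Bernstein
    by (simp add: algebra_simps power2_eq_square)
qed

lemma weighted_sum_le_sqrt:
  fixes w d :: "'a \<Rightarrow> real"
  assumes "\<And>j. j \<in> I \<Longrightarrow> 0 \<le> w j" "(\<Sum>j\<in>I. w j) \<le> 1" "(\<Sum>j\<in>I. w j * (d j)\<^sup>2) \<le> v" "0 < v"
  shows "(\<Sum>j\<in>I. w j * \<bar>d j\<bar>) \<le> sqrt v"
proof -
  define s where "s = sqrt v"
  have s: "0 < s" "s * s = v" using assms(4) by (auto simp: s_def)
  have "w j * \<bar>d j\<bar> \<le> (w j * (d j)\<^sup>2) * (1 / (2 * s)) + w j * (s / 2)" if "j \<in> I" for j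
  proof -
    have "0 \<le> (\<bar>d j\<bar> - s)\<^sup>2" by simp
    then have "2 * s * \<bar>d j\<bar> \<le> (d j)\<^sup>2 + s * s"
      by (simp add: power2_diff power2_eq_square algebra_simps)
    then have "\<bar>d j\<bar> \<le> (d j)\<^sup>2 * (1 / (2 * s)) + s / 2"
      using s(1) by (simp add: field_simps)
    from mult_left_mono[OF this assms(1)[OF that]] show ?thesis by (simp add: algebra_simps)
  qed
  then have "(\<Sum>j\<in>I. w j * \<bar>d j\<bar>) \<le> (\<Sum>j\<in>I. w j * (d j)\<^sup>2) * (1 / (2 * s)) + (\<Sum>j\<in>I. w j) * (s / 2)"
    unfolding sum_distrib_right sum.distrib[symmetric] by (rule sum_mono)
  also have "\<dots> \<le> v * (1 / (2 * s)) + 1 * (s / 2)"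
    using assms(2,3) s(1) by (intro add_mono mult_right_mono) auto
  also have "\<dots> = s" using s by (simp add: field_simps flip: s(2))
  finally show ?thesis unfolding s_def .
qed

lemma sum_abs_Bernstein_diff:
  assumes "0 < r" "r < 1"
  shows "(\<Sum>j\<le>Suc h. \<bar>Bernstein (Suc h) j r - Bernstein h j r\<bar>) \<le> sqrt (r / ((1 - r) * (real h + 1)))"
proof -
  let ?d = "\<lambda>j. (real j - real (Suc h) * r) / (real (Suc h) * (1 - r))"
  have eq: "Bernstein (Suc h) j r - Bernstein h j r = Bernstein (Suc h) j r * ?d j" if "j \<le> Suc h" for j
  proof -
    have "real (Suc h choose j) * (real (Suc h) - real j) = real (Suc h) * real (h choose j)"
    proof (cases "j \<le> h")
      case True
      have "(Suc h - j) * (Suc h choose j) = Suc h * (h choose j)"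
        using binomial_absorb_comp[of "Suc h" j] by simp
      then have "real (Suc h - j) * real (Suc h choose j) = real (Suc h) * real (h choose j)"
        by (simp only: of_nat_mult[symmetric])
      then show ?thesis using that by (simp add: of_nat_diff mult.commute)
    next
      case False
      then show ?thesis using that by (simp add: not_le le_Suc_eq)
    qed
    then have "Bernstein h j r * (real (Suc h) * (1 - r)) = Bernstein (Suc h) j r * (real (Suc h) - real j)"
    proof (cases "j \<le> h")
      case True
      then have "Bernstein h j r * (real (Suc h) * (1 - r)) =
          (real (Suc h) * real (h choose j)) * (r ^ j * (1 - r) ^ (Suc h - j))"
        by (simp add: Bernstein_def Suc_diff_le)
      also have "\<dots> = Bernstein (Suc h) j r * (real (Suc h) - real j)"
        unfolding \<open>real (Suc h choose j) * (real (Suc h) - real j) = real (Suc h) * real (h choose j)\<close>[symmetric]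
        by (simp only: Bernstein_def mult_ac)
      finally show ?thesis .
    next
      case False
      then have "j = Suc h" using that by simp
      then show ?thesis by (simp add: Bernstein_eq_0)
    qed
    moreover have pos: "0 < real (Suc h) * (1 - r)" using assms by simp
    ultimately have "Bernstein h j r = Bernstein (Suc h) j r * (real (Suc h) - real j) / (real (Suc h) * (1 - r))"
      by (metis nonzero_mult_div_cancel_right less_irrefl)
    also have "(real (Suc h) - real j) = real (Suc h) * (1 - r) - (real j - real (Suc h) * r)"
      by (simp add: algebra_simps)
    also have "Bernstein (Suc h) j r * \<dots> / (real (Suc h) * (1 - r)) = Bernstein (Suc h) j r - Bernstein (Suc h) j r * ?d j"
      unfolding right_diff_distrib[of "Bernstein (Suc h) j r" "real (Suc h) * (1 - r)"]
        diff_divide_distrib[of "Bernstein (Suc h) j r * (real (Suc h) * (1 - r))"]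
      using pos by (simp only: times_divide_eq_right nonzero_mult_div_cancel_right less_irrefl)
    finally show ?thesis by simp
  qed
  have "(\<Sum>j\<le>Suc h. \<bar>Bernstein (Suc h) j r - Bernstein h j r\<bar>) = (\<Sum>j\<le>Suc h. Bernstein (Suc h) j r * \<bar>?d j\<bar>)"
    using assms by (intro sum.cong refl) (simp only: eq atMost_iff abs_mult, simp add: Bernstein_nonneg)
  also have "\<dots> \<le> sqrt (r / ((1 - r) * (real h + 1)))"
  proof (rule weighted_sum_le_sqrt)
    have "(\<Sum>j\<le>Suc h. Bernstein (Suc h) j r * (?d j)\<^sup>2) =
        (\<Sum>j\<le>Suc h. Bernstein (Suc h) j r * (real j - real (Suc h) * r)\<^sup>2) / (real (Suc h) * (1 - r))\<^sup>2"
      by (simp only: power_divide sum_divide_distrib times_divide_eq_right)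
    also have "\<dots> = r / ((1 - r) * (real h + 1))"
    proof -
      have "S * r * u / (S * u)\<^sup>2 = r / (u * S)" if "0 < S" "0 < u" for S u :: real
        using that by (simp add: power2_eq_square field_simps)
      then show ?thesis
        unfolding Bernstein_variance using assms by (simp add: add.commute)
    qed
    finally show "(\<Sum>j\<le>Suc h. Bernstein (Suc h) j r * (?d j)\<^sup>2) \<le> r / ((1 - r) * (real h + 1))"
      by simp
    show "(\<Sum>j\<le>Suc h. Bernstein (Suc h) j r) \<le> 1" by (simp only: sum_Bernstein order_refl)
  qed (use assms in \<open>auto simp: Bernstein_nonneg\<close>)
  finally show ?thesis .
qed

text \<open>Powers of a lazy contraction form a slowly varying sequence; all gains in the proof of the
  theorem come from this estimate.\<close>

lemma mix_op_funpow_diff: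
  assumes "bounded_op 1 S" "0 < r" "r < 1" and F: "\<And>z. \<bar>F z\<bar> \<le> M"
  shows "\<bar>(mix_op r S ^^ Suc h) F z - (mix_op r S ^^ h) F z\<bar> \<le> sqrt (r / ((1 - r) * (real h + 1))) * M"
proof -
  have M: "0 \<le> M" using F[of z] by simp
  have "(mix_op r S ^^ h) F z = (\<Sum>j\<le>Suc h. Bernstein h j r * (S ^^ j) F z)"
    by (simp add: mix_op_funpow[OF assms(1)] Bernstein_eq_0)
  then have "(mix_op r S ^^ Suc h) F z - (mix_op r S ^^ h) F z =
      (\<Sum>j\<le>Suc h. (Bernstein (Suc h) j r - Bernstein h j r) * (S ^^ j) F z)"
    by (simp only: mix_op_funpow[OF assms(1)] left_diff_distrib sum_subtractf)
  also have "\<bar>\<dots>\<bar> \<le> (\<Sum>j\<le>Suc h. \<bar>Bernstein (Suc h) j r - Bernstein h j r\<bar> * M)"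
    by (rule order_trans[OF sum_abs])
      (intro sum_mono, simp add: abs_mult mult_left_mono bounded_op_le1[OF bounded_op_funpow[OF assms(1)]] F)
  also have "\<dots> \<le> sqrt (r / ((1 - r) * (real h + 1))) * M"
    unfolding sum_distrib_right[symmetric]
    by (intro mult_right_mono sum_abs_Bernstein_diff assms M)
  finally show ?thesis .
qed

lemma Bernstein_le_sqrt:
  assumes "0 < x" "x < 1"
  shows "Bernstein n j x \<le> 1 / sqrt (x * (1 - x) * (real n + 1))"
proof -
  let ?S = "\<lambda>(F :: nat \<Rightarrow> real) i. F (Suc i)"
  let ?F = "\<lambda>i. if i \<le> j then 1 else (0 :: real)"
  have S: "bounded_op 1 ?S" by (rule bounded_op_point)
  have Sj: "(?S ^^ i) ?F 0 = ?F i" for i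
  proof -
    have "(?S ^^ i) F k = F (i + k)" for F k
      by (induction i arbitrary: k) (simp_all add: add.commute)
    then show ?thesis by simp
  qed
  have "(mix_op x ?S ^^ Suc n) ?F 0 - (mix_op x ?S ^^ n) ?F 0 =
      x * ((\<Sum>i\<le>n. Bernstein n i x * ?F (Suc i)) - (\<Sum>i\<le>n. Bernstein n i x * ?F i))"
    unfolding mix_op_funpow[OF S] Sj sum_Bernstein_Suc by (simp add: algebra_simps)
  also have "(\<Sum>i\<le>n. Bernstein n i x * ?F (Suc i)) - (\<Sum>i\<le>n. Bernstein n i x * ?F i) =
      (\<Sum>i\<le>n. if i = j then - Bernstein n i x else 0)"
    unfolding sum_subtractf[symmetric] by (intro sum.cong) auto
  also have "\<dots> = - Bernstein n j x"
    by (simp add: Bernstein_eq_0)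
  finally have "x * Bernstein n j x \<le> sqrt (x / ((1 - x) * (real n + 1)))"
    using mix_op_funpow_diff[OF S assms, of ?F 1 n 0] by fastforce
  also have "\<dots> = x * (1 / sqrt (x * (1 - x) * (real n + 1)))"
  proof -
    have "x / ((1 - x) * (real n + 1)) = x\<^sup>2 / (x * (1 - x) * (real n + 1))"
      using assms by (simp add: power2_eq_square mult.assoc)
    then show ?thesis using assms by (simp add: real_sqrt_divide)
  qed
  finally show ?thesis using assms by (simp only: mult_le_cancel_left_pos)
qed

lemma sum_Bernstein_inverse_sqrt:
  assumes "0 < r" "r \<le> 1"
  shows "(\<Sum>i\<le>k. Bernstein k i r * (1 / sqrt (real i + 1))) \<le> 1 / sqrt ((real k + 1) * r)"
proof -
  have eq: "Bernstein k i r * (1 / sqrt (real i + 1))\<^sup>2 = Bernstein (Suc k) (Suc i) r / ((real k + 1) * r)" for i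
  proof -
    have "Suc i * (Suc k choose Suc i) = Suc k * (k choose i)"
      by (rule Suc_times_binomial)
    then have "real (Suc i) * real (Suc k choose Suc i) = real (Suc k) * real (k choose i)"
      by (simp only: of_nat_mult[symmetric])
    then have "real (k choose i) = (real i + 1) * real (Suc k choose Suc i) / (real k + 1)"
      by (simp add: field_simps)
    then have "Bernstein k i r * (1 / sqrt (real i + 1))\<^sup>2 =
        ((real i + 1) * real (Suc k choose Suc i) / (real k + 1)) * (r ^ i * (1 - r) ^ (k - i)) * (1 / (real i + 1))"
      by (simp only: Bernstein_def) (simp add: power_divide)
    also have "\<dots> = Bernstein (Suc k) (Suc i) r / ((real k + 1) * r)"
      using assms by (simp add: Bernstein_def del: binomial_Suc_Suc)
    finally show ?thesis .
  qed
  have "(\<Sum>i\<le>k. Bernstein k i r * \<bar>1 / sqrt (real i + 1)\<bar>) \<le> sqrt (1 / ((real k + 1) * r))"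
  proof (rule weighted_sum_le_sqrt)
    have "(\<Sum>i\<le>k. Bernstein (Suc k) (Suc i) r) \<le> 1"
      using sum_Bernstein[of "Suc k" r] Bernstein_nonneg[of r "Suc k" 0] assms
      unfolding sum.atMost_Suc_shift[of _ k] by linarith
    then show "(\<Sum>i\<le>k. Bernstein k i r * (1 / sqrt (real i + 1))\<^sup>2) \<le> 1 / ((real k + 1) * r)"
      unfolding eq sum_divide_distrib[symmetric] using assms by (intro divide_right_mono) auto
  qed (use assms in \<open>auto simp: Bernstein_nonneg\<close>)
  then show ?thesis by (simp add: real_sqrt_divide)
qed

section \<open>Convolution operators on count vectors\<close>

type_synonym vec = "nat \<Rightarrow> nat"

definition bump :: "nat \<Rightarrow> bool \<Rightarrow> vec \<Rightarrow> vec" where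
  "bump i b s = (if b then s(i := Suc (s i)) else s)"

primrec add_bits :: "bits \<Rightarrow> nat \<Rightarrow> vec \<Rightarrow> vec" where
  "add_bits [] l s = s"
| "add_bits (b # t) l s = add_bits t (Suc l) (bump l b s)"

definition translation :: "nat \<Rightarrow> (vec \<Rightarrow> real) \<Rightarrow> vec \<Rightarrow> real" where
  "translation i F s = F (bump i True s)"

definition delta :: "nat \<Rightarrow> (vec \<Rightarrow> real) \<Rightarrow> vec \<Rightarrow> real" where
  "delta i F s = translation i F s - F s"

definition coin :: "nat \<Rightarrow> (vec \<Rightarrow> real) \<Rightarrow> vec \<Rightarrow> real" where
  "coin i = mix_op (1 / 2) (translation i)"

lemma bump_False [simp]: "bump i False s = s"
  by (simp add: bump_def)

lemma bump_commute: "bump i b (bump j c s) = bump j c (bump i b s)"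
  by (auto simp: bump_def fun_eq_iff)

lemma add_bits_bump: "add_bits t l (bump j c s) = bump j c (add_bits t l s)"
  by (induction t arbitrary: l s) (simp_all add: bump_commute[of _ _ j])

lemma add_bits_commute: "add_bits t l (add_bits t' l' s) = add_bits t' l' (add_bits t l s)"
  by (induction t arbitrary: l s) (simp_all add: add_bits_bump)

lemma add_bits_append: "add_bits (t @ t') l s = add_bits t' (l + length t) (add_bits t l s)"
  by (induction t arbitrary: l s) simp_all

lemma add_bits_apply:
  "add_bits t l s j = s j + (if l \<le> j \<and> j - l < length t \<and> t ! (j - l) then 1 else 0)"
proof (induction t arbitrary: j l s)
  case (Cons b t)
  note IH = Cons
  consider "j < l" | "j = l" | k where "j = Suc (l + k)"
    by (metis less_imp_Suc_add not_less_iff_gr_or_eq)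
  then show ?case by cases (auto simp: IH bump_def)
qed simp

lemma add_bits_append_bit:
  "add_bits (u @ b # v) l s = bump (l + length u) b (add_bits (u @ False # v) l s)"
  by (simp add: add_bits_append add_bits_bump)

lemma bounded_op_translation: "bounded_op 1 (translation i)"
  unfolding translation_def[abs_def] by (rule bounded_op_point)

lemma coin_eq: "coin i F s = (F s + F (bump i True s)) / 2"
  by (simp add: coin_def mix_op_def translation_def)

text \<open>Averaging operators that commute with translations: the convolution operators of
  sub-probability measures on the lattice.\<close>

definition conv_op :: "real \<Rightarrow> ((vec \<Rightarrow> real) \<Rightarrow> vec \<Rightarrow> real) \<Rightarrow> bool" where
  "conv_op w S \<longleftrightarrow> bounded_op w S \<and> (\<forall>i F s. S F (bump i True s) = S (\<lambda>s. F (bump i True s)) s)"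

lemma conv_opI:
  "bounded_op w S \<Longrightarrow> (\<And>i F s. S F (bump i True s) = S (\<lambda>s. F (bump i True s)) s) \<Longrightarrow> conv_op w S"
  by (simp add: conv_op_def)

lemma conv_op_bounded: "conv_op w S \<Longrightarrow> bounded_op w S"
  by (simp add: conv_op_def)

lemma conv_op_bump: "conv_op w S \<Longrightarrow> S F (bump i True s) = S (\<lambda>s. F (bump i True s)) s"
  by (simp add: conv_op_def)

lemma conv_op_delta:
  assumes S: "conv_op w S" shows "delta i (S F) = S (delta i F)"
  by (rule ext)
    (simp add: delta_def[abs_def] translation_def conv_op_bump[OF S] bounded_op_diff[OF conv_op_bounded[OF S]])

lemma conv_op_coin:
  assumes S: "conv_op w S" shows "coin i (S F) = S (coin i F)"
proof (rule ext)
  fix s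
  have "S (coin i F) s = S (\<lambda>s. (1 / 2) * F s + (1 / 2) * F (bump i True s)) s"
    by (simp add: coin_eq[abs_def] add_divide_distrib)
  also have "\<dots> = (1 / 2) * S F s + (1 / 2) * S F (bump i True s)"
    by (simp only: bounded_op_linear[OF conv_op_bounded[OF S]] conv_op_bump[OF S])
  finally show "coin i (S F) s = S (coin i F) s"
    by (simp add: coin_eq)
qed

lemma conv_op_coin_funpow: "conv_op w S \<Longrightarrow> (coin i ^^ r) (S F) = S ((coin i ^^ r) F)"
  by (induction r) (simp_all add: conv_op_coin)

lemma conv_op_id: "conv_op 1 (\<lambda>F. F)"
  by (rule conv_opI[OF bounded_op_id]) simp

lemma conv_op_zero: "conv_op 0 (\<lambda>F s. 0)"
  by (rule conv_opI) (auto intro: bounded_opI)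

lemma conv_op_plus: "conv_op v R \<Longrightarrow> conv_op w S \<Longrightarrow> conv_op (v + w) (\<lambda>F s. R F s + S F s)"
  by (auto simp: conv_op_def intro: bounded_op_plus)

lemma conv_op_scale: "conv_op w S \<Longrightarrow> 0 \<le> r \<Longrightarrow> conv_op (r * w) (\<lambda>F s. r * S F s)"
  by (auto simp: conv_op_def intro: bounded_op_scale)

lemma conv_op_translate: "conv_op w S \<Longrightarrow> conv_op w (\<lambda>F s. S F (bump i b s))"
  using bounded_op_comp[OF bounded_op_point[of "bump i b"], of w S]
  by (cases b) (auto simp: conv_op_def bump_commute)

lemma conv_op_comp: "conv_op v R \<Longrightarrow> conv_op w S \<Longrightarrow> conv_op (v * w) (\<lambda>F. R (S F))"
  using bounded_op_comp[of v R w S] by (simp add: conv_op_def)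

lemma conv_op_comp1: "conv_op 1 R \<Longrightarrow> conv_op 1 S \<Longrightarrow> conv_op 1 (\<lambda>F. R (S F))"
  using conv_op_comp[of 1 R 1 S] by simp

lemma conv_op_funpow:
  assumes "conv_op 1 S" shows "conv_op 1 (S ^^ k)"
proof (induction k)
  case 0 show ?case using conv_op_id by (simp add: id_def)
next
  case (Suc k) then show ?case using conv_op_comp1[OF assms Suc] by (simp add: comp_def)
qed

text \<open>\<open>splits m w X j\<close>: the operator \<open>X\<close> has total mass \<open>m\<close>, of which the mass \<open>w\<close> contains a fair
  coin flip in coordinate \<open>j\<close> as an independent factor.\<close>

definition splits :: "real \<Rightarrow> real \<Rightarrow> ((vec \<Rightarrow> real) \<Rightarrow> vec \<Rightarrow> real) \<Rightarrow> nat \<Rightarrow> bool" where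
  "splits m w X j \<longleftrightarrow>
     (\<exists>N H. conv_op (m - w) N \<and> conv_op w H \<and> (\<forall>F s. X F s = N F s + H (coin j F) s))"

lemma splitsI:
  "conv_op (m - w) N \<Longrightarrow> conv_op w H \<Longrightarrow> (\<And>F s. X F s = N F s + H (coin j F) s) \<Longrightarrow> splits m w X j"
  unfolding splits_def by blast

lemma splits_trivial: "conv_op m X \<Longrightarrow> splits m 0 X j"
  by (rule splitsI[OF _ conv_op_zero]) auto

lemma splits_coin: "conv_op m X \<Longrightarrow> splits m m (\<lambda>F. X (coin j F)) j"
  by (rule splitsI[of m m "\<lambda>F s. 0" X]) (auto simp: conv_op_zero)

lemma splits_plus:
  assumes "splits m w X j" "splits m' w' X' j"
  shows "splits (m + m') (w + w') (\<lambda>F s. X F s + X' F s) j"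
proof -
  obtain N H N' H' where *: "conv_op (m - w) N" "conv_op w H" "\<And>F s. X F s = N F s + H (coin j F) s"
      "conv_op (m' - w') N'" "conv_op w' H'" "\<And>F s. X' F s = N' F s + H' (coin j F) s"
    using assms unfolding splits_def by blast
  have "conv_op (m + m' - (w + w')) (\<lambda>F s. N F s + N' F s)"
    using conv_op_plus[OF *(1,4)] by (simp add: algebra_simps)
  then show ?thesis
    by (rule splitsI[OF _ conv_op_plus[OF *(2,5)]]) (simp add: *(3,6))
qed

lemma splits_scale:
  assumes "splits m w X j" "0 \<le> r" shows "splits (r * m) (r * w) (\<lambda>F s. r * X F s) j"
proof -
  obtain N H where *: "conv_op (m - w) N" "conv_op w H" "\<And>F s. X F s = N F s + H (coin j F) s"
    using assms unfolding splits_def by blast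
  have "conv_op (r * m - r * w) (\<lambda>F s. r * N F s)"
    using conv_op_scale[OF *(1) assms(2)] by (simp add: right_diff_distrib)
  then show ?thesis
    by (rule splitsI[OF _ conv_op_scale[OF *(2) assms(2)]]) (simp add: *(3) distrib_left)
qed

lemma splits_translate:
  assumes "splits m w X j" shows "splits m w (\<lambda>F s. X F (bump i b s)) j"
proof -
  obtain N H where *: "conv_op (m - w) N" "conv_op w H" "\<And>F s. X F s = N F s + H (coin j F) s"
    using assms unfolding splits_def by blast
  show ?thesis
    by (rule splitsI[OF conv_op_translate[OF *(1)] conv_op_translate[OF *(2)]]) (simp add: *(3))
qed

lemma splits_bounds:
  assumes "splits m w X j" shows "0 \<le> w" "w \<le> m"
  using assms bounded_op_nonneg[OF conv_op_bounded] unfolding splits_def by fastforce+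

lemma abs_delta_coin_funpow:
  assumes "\<And>s. \<bar>F s\<bar> \<le> M"
  shows "\<bar>delta j ((coin j ^^ r) F) s\<bar> \<le> 2 * M * (1 / sqrt (real r + 1))"
proof -
  have "delta j ((coin j ^^ r) F) s = 2 * ((coin j ^^ Suc r) F s - (coin j ^^ r) F s)"
    by (simp add: delta_def translation_def coin_eq)
  then show ?thesis
    using mix_op_funpow_diff[OF bounded_op_translation[of j], where r = "1 / 2" and h = r and z = s and F = F and M = M] assms
    by (simp add: coin_def abs_mult real_sqrt_divide)
qed

lemma splits_smooth:
  assumes D: "splits 1 w D j" "conv_op 1 D" and w: "0 < w" and F: "\<And>s. \<bar>F s\<bar> \<le> M"
  shows "\<bar>delta j ((D ^^ k) F) s\<bar> \<le> 2 * M / sqrt ((real k + 1) * w)"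
proof -
  obtain N H where NH: "conv_op (1 - w) N" "conv_op w H" "\<And>F s. D F s = N F s + H (coin j F) s"
    using D(1) unfolding splits_def by blast
  have w1: "w \<le> 1" using splits_bounds[OF D(1)] by simp
  let ?S = "\<lambda>(b :: nat \<Rightarrow> real) r. b (Suc r)"
  let ?b = "\<lambda>r. 2 * M * (1 / sqrt (real r + 1))"
  let ?V = "\<lambda>k. (mix_op w ?S ^^ k) ?b"
  have V: "\<bar>delta j ((coin j ^^ r) ((D ^^ k) F)) s\<bar> \<le> ?V k r" for r s
  proof (induction k arbitrary: r s)
    case 0
    show ?case using abs_delta_coin_funpow[OF F] by simp
  next
    case (Suc k)
    let ?G = "(D ^^ k) F"
    have 1: "\<bar>N (delta j ((coin j ^^ r) ?G)) s\<bar> \<le> (1 - w) * ?V k r"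
      by (rule bounded_op_le[OF conv_op_bounded[OF NH(1)] Suc])
    have 2: "\<bar>H (delta j ((coin j ^^ Suc r) ?G)) s\<bar> \<le> w * ?V k (Suc r)"
      by (rule bounded_op_le[OF conv_op_bounded[OF NH(2)] Suc])
    have "D ?G = (\<lambda>s. N ?G s + H (coin j ?G) s)" using NH(3) by (simp add: fun_eq_iff)
    moreover have "delta j ((coin j ^^ r) (D ?G)) = D (delta j ((coin j ^^ r) ?G))"
      by (simp add: conv_op_coin_funpow[OF D(2)] conv_op_delta[OF D(2)])
    ultimately have "delta j ((coin j ^^ r) ((D ^^ Suc k) F)) s =
        N (delta j ((coin j ^^ r) ?G)) s + H (delta j ((coin j ^^ Suc r) ?G)) s"
      by (simp add: NH(3) conv_op_delta[OF NH(2), symmetric] conv_op_coin[OF NH(2), symmetric] conv_op_id)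
        (simp add: delta_def[abs_def] translation_def coin_eq[abs_def] diff_divide_distrib add_divide_distrib)
    moreover have "?V (Suc k) r = (1 - w) * ?V k r + w * ?V k (Suc r)"
      by (simp only: funpow.simps comp_def mix_op_def[of w ?S "?V k"])
    ultimately show ?case using 1 2 by linarith
  qed
  have Sj: "(?S ^^ i) F r = F (i + r)" for i F r
    by (induction i arbitrary: r) (simp_all add: add.commute)
  have "?V k 0 = 2 * M * (\<Sum>i\<le>k. Bernstein k i w * (1 / sqrt (real i + 1)))"
    unfolding mix_op_funpow[OF bounded_op_point] Sj sum_distrib_left by (intro sum.cong) auto
  also have "\<dots> \<le> 2 * M * (1 / sqrt ((real k + 1) * w))"
    using F[of s] by (intro mult_left_mono sum_Bernstein_inverse_sqrt w w1) auto
  finally show ?thesis using V[of 0 s] by simp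
qed

section \<open>Traces\<close>

locale deletion_channel =
  fixes p :: real
  assumes p: "0 < p" "p < 1"
begin

primrec trace_exp :: "bits \<Rightarrow> (bits \<Rightarrow> real) \<Rightarrow> real" where
  "trace_exp [] g = g []"
| "trace_exp (b # x) g = p * trace_exp x g + (1 - p) * trace_exp x (\<lambda>t. g (b # t))"

lemma trace_exp_linear:
  "trace_exp x (\<lambda>t. c * g t + d * h t) = c * trace_exp x g + d * trace_exp x h"
  by (induction x arbitrary: g h) (simp_all add: algebra_simps)

lemma trace_exp_add: "trace_exp x (\<lambda>t. g t + h t) = trace_exp x g + trace_exp x h"
  using trace_exp_linear[of x 1 g 1 h] by simp

lemma trace_exp_diff: "trace_exp x (\<lambda>t. g t - h t) = trace_exp x g - trace_exp x h"
  using trace_exp_linear[of x 1 g "-1" h] by simp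

lemma trace_exp_cong_length:
  assumes "\<And>t. length t \<le> length x \<Longrightarrow> g t = h t" shows "trace_exp x g = trace_exp x h"
  using assms
proof (induction x arbitrary: g h)
  case (Cons b x)
  have "trace_exp x g = trace_exp x h" "trace_exp x (\<lambda>t. g (b # t)) = trace_exp x (\<lambda>t. h (b # t))"
    by (rule Cons.IH, rule Cons.prems, simp)+
  then show ?case by simp
qed simp

lemma trace_exp_abs_le:
  assumes "\<And>t. length t \<le> length x \<Longrightarrow> \<bar>g t\<bar> \<le> M" shows "\<bar>trace_exp x g\<bar> \<le> M"
  using assms
proof (induction x arbitrary: g)
  case (Cons b x)
  have "\<bar>trace_exp x g\<bar> \<le> M" "\<bar>trace_exp x (\<lambda>t. g (b # t))\<bar> \<le> M"
    by (rule Cons.IH, rule Cons.prems, simp)+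
  then have "\<bar>p * trace_exp x g\<bar> \<le> p * M" "\<bar>(1 - p) * trace_exp x (\<lambda>t. g (b # t))\<bar> \<le> (1 - p) * M"
    using p by (simp_all add: abs_mult mult_left_mono)
  then show ?case by (simp add: algebra_simps)
qed simp

lemma trace_exp_append: "trace_exp (x @ y) g = trace_exp x (\<lambda>t. trace_exp y (\<lambda>t'. g (t @ t')))"
  by (induction x arbitrary: g) simp_all

lemma trace_exp_swap:
  "trace_exp x (\<lambda>t. trace_exp y (\<lambda>t'. g t t')) = trace_exp y (\<lambda>t'. trace_exp x (\<lambda>t. g t t'))"
  by (induction x arbitrary: g) (simp_all add: trace_exp_linear)

lemma expectation_trace_pmf: "measure_pmf.expectation (trace_pmf p x) g = trace_exp x g"
proof (induction x arbitrary: g)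
  case (Cons b x)
  have fin: "finite (set_pmf (trace_pmf p y))" for y
    by (induction y) auto
  have "trace_pmf p (b # x) =
      bernoulli_pmf p \<bind> (\<lambda>d. map_pmf (\<lambda>t. if d then t else b # t) (trace_pmf p x))"
    by (simp add: map_pmf_def)
  also have "measure_pmf.expectation \<dots> g =
      (\<Sum>d\<in>UNIV. pmf (bernoulli_pmf p) d *\<^sub>R trace_exp x (\<lambda>t. g (if d then t else b # t)))"
    using fin[of x] by (subst pmf_expectation_bind[OF finite _ subset_UNIV]) (simp_all add: Cons)
  also have "\<dots> = trace_exp (b # x) g"
    using p by (simp add: UNIV_bool)
  finally show ?case .
qed simp

definition trace_op :: "bits \<Rightarrow> nat \<Rightarrow> (vec \<Rightarrow> real) \<Rightarrow> vec \<Rightarrow> real" where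
  "trace_op x l F s = trace_exp x (\<lambda>t. F (add_bits t l s))"

lemma trace_op_Cons:
  "trace_op (b # x) l F s = p * trace_op x l F s + (1 - p) * trace_op x (Suc l) F (bump l b s)"
  by (simp add: trace_op_def)

lemma conv_op_trace_op: "conv_op 1 (trace_op x l)"
  by (auto intro!: conv_opI bounded_opI trace_exp_abs_le simp: trace_op_def trace_exp_linear add_bits_bump)

lemma trace_op_commute: "trace_op x l (trace_op y l' F) = trace_op y l' (trace_op x l F)"
  unfolding trace_op_def fun_eq_iff
  by (subst trace_exp_swap) (simp add: add_bits_commute)

text \<open>If exactly one bit of a block \<open>b c\<close> with \<open>b \<noteq> c\<close> survives, then its value is a fair coin flip.
  \<open>coin_mass x j\<close> is the probability that this happens at an aligned block of \<open>x\<close> whose surviving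
  bit is bit \<open>j\<close> of the trace.\<close>

fun coin_mass :: "bits \<Rightarrow> nat \<Rightarrow> real" where
  "coin_mass (b # c # x) j =
     (if b \<noteq> c \<and> j = 0 then 2 * p * (1 - p) else 0) + p\<^sup>2 * coin_mass x j
     + (if 1 \<le> j then 2 * p * (1 - p) * coin_mass x (j - 1) else 0)
     + (if 2 \<le> j then (1 - p)\<^sup>2 * coin_mass x (j - 2) else 0)"
| "coin_mass x j = 0"

lemma splits_trace_op: "splits 1 (coin_mass x j) (trace_op x l) (l + j)"
proof (induction x j arbitrary: l rule: coin_mass.induct)
  case (1 b c x j)
  let ?q = "1 - p"
  let ?B = "if b \<noteq> c \<and> j = 0 then 2 * p * ?q else 0"
  let ?X2 = "\<lambda>F s. p * ?q * trace_op x (Suc l) F (bump l b s) + p * ?q * trace_op x (Suc l) F (bump l c s)"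
  let ?X3 = "\<lambda>F s. trace_op x (Suc (Suc l)) F (bump (Suc l) c (bump l b s))"
  have X1: "splits 1 (coin_mass x j) (trace_op x l) (l + j)"
    using 1 by simp
  have X2: "splits (2 * p * ?q) (?B + (if 1 \<le> j then 2 * p * ?q * coin_mass x (j - 1) else 0)) ?X2 (l + j)"
  proof (cases j)
    case 0
    show ?thesis
    proof (cases "b = c")
      case True
      have "conv_op (p * ?q * 1 + p * ?q * 1) ?X2"
        using p by (intro conv_op_plus conv_op_scale conv_op_translate conv_op_trace_op) auto
      from splits_trivial[OF this] show ?thesis using 0 True by (simp add: mult.assoc)
    next
      case False
      have "splits (2 * p * ?q * 1) (2 * p * ?q * 1) (\<lambda>F s. 2 * p * ?q * trace_op x (Suc l) (coin l F) s) l"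
        using p by (intro splits_scale splits_coin conv_op_trace_op) auto
      moreover have "?X2 F s = 2 * p * ?q * trace_op x (Suc l) (coin l F) s" for F s
        unfolding conv_op_coin[OF conv_op_trace_op, symmetric] coin_eq
        using False by (cases b) (simp_all add: algebra_simps)
      ultimately show ?thesis using 0 False by simp
    qed
  next
    case (Suc i)
    have "splits 1 (coin_mass x i) (trace_op x (Suc l)) (l + j)"
      using 1[of "Suc l"] Suc by simp
    then have "splits (p * ?q * 1 + p * ?q * 1) (p * ?q * coin_mass x i + p * ?q * coin_mass x i) ?X2 (l + j)"
      using p by (intro splits_plus splits_scale splits_translate) auto
    then show ?thesis using Suc by (simp add: algebra_simps)
  qed
  have X3: "splits 1 (if 2 \<le> j then coin_mass x (j - 2) else 0) ?X3 (l + j)"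
  proof (cases "2 \<le> j")
    case True
    then obtain i where i: "j = Suc (Suc i)" by (metis add_2_eq_Suc le_Suc_ex)
    have "splits 1 (coin_mass x i) (trace_op x (Suc (Suc l))) (l + j)"
      using 1[of "Suc (Suc l)"] i by simp
    then show ?thesis using i by (auto intro!: splits_translate)
  next
    case False
    have "conv_op 1 ?X3" by (intro conv_op_translate conv_op_trace_op)
    from splits_trivial[OF this] show ?thesis using False by simp
  qed
  have "splits (p\<^sup>2 * 1 + 2 * p * ?q + ?q\<^sup>2 * 1)
     (p\<^sup>2 * coin_mass x j + (?B + (if 1 \<le> j then 2 * p * ?q * coin_mass x (j - 1) else 0))
       + ?q\<^sup>2 * (if 2 \<le> j then coin_mass x (j - 2) else 0))
     (\<lambda>F s. p\<^sup>2 * trace_op x l F s + ?X2 F s + ?q\<^sup>2 * ?X3 F s) (l + j)"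
    by (intro splits_plus splits_scale X1 X2 X3) auto
  moreover have "p\<^sup>2 * 1 + 2 * p * ?q + ?q\<^sup>2 * 1 = 1"
    by (simp add: power2_eq_square algebra_simps)
  moreover have "(\<lambda>F s. p\<^sup>2 * trace_op x l F s + ?X2 F s + ?q\<^sup>2 * ?X3 F s) = trace_op (b # c # x) l"
    by (intro ext) (simp add: trace_op_Cons power2_eq_square algebra_simps)
  moreover have "p\<^sup>2 * coin_mass x j + (?B + (if 1 \<le> j then 2 * p * ?q * coin_mass x (j - 1) else 0))
       + ?q\<^sup>2 * (if 2 \<le> j then coin_mass x (j - 2) else 0) = coin_mass (b # c # x) j"
    by simp
  ultimately show ?case by (simp only:)
qed (auto intro: splits_trivial conv_op_trace_op)

lemma coin_mass_eq:
  "coin_mass x j =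
     2 * p * (1 - p) *
       (\<Sum>h<length x div 2. if x ! (2 * h) \<noteq> x ! Suc (2 * h) then Bernstein (2 * h) j (1 - p) else 0)"
proof (induction x j rule: coin_mass.induct)
  case (1 b c x j)
  let ?q = "1 - p"
  let ?w = "\<lambda>h j. if x ! (2 * h) \<noteq> x ! Suc (2 * h) then Bernstein (2 * h) j ?q else 0"
  define S where "S = (\<lambda>j. \<Sum>h<length x div 2. ?w h j)"
  define C where "C = 2 * p * ?q"
  have IH: "coin_mass x j = C * S j" "1 \<le> j \<Longrightarrow> coin_mass x (j - 1) = C * S (j - 1)"
    "2 \<le> j \<Longrightarrow> coin_mass x (j - 2) = C * S (j - 2)"
    unfolding C_def S_def by (rule 1, assumption?)+
  have B: "Bernstein (Suc (Suc n)) j ?q = p\<^sup>2 * Bernstein n j ?q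
      + (if 1 \<le> j then 2 * p * ?q * Bernstein n (j - 1) ?q else 0)
      + (if 2 \<le> j then ?q\<^sup>2 * Bernstein n (j - 2) ?q else 0)" for n
  proof -
    consider "j = 0" | "j = 1" | i where "j = Suc (Suc i)"
      by (metis One_nat_def not0_implies_Suc)
    then show ?thesis
      by cases (simp_all add: Bernstein_Suc_0 Bernstein_Suc_Suc power2_eq_square algebra_simps)
  qed
  have two: "2 * Suc i = Suc (Suc (2 * i))" for i :: nat by simp
  have "(\<Sum>h<length (b # c # x) div 2. if (b # c # x) ! (2 * h) \<noteq> (b # c # x) ! Suc (2 * h)
        then Bernstein (2 * h) j ?q else 0) =
      (if b \<noteq> c then Bernstein 0 j ?q else 0) +
      (\<Sum>h<length x div 2. if x ! (2 * h) \<noteq> x ! Suc (2 * h) then Bernstein (Suc (Suc (2 * h))) j ?q else 0)"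
    by (simp del: sum.lessThan_Suc add: sum.lessThan_Suc_shift two cong: if_cong)
  also have "(\<Sum>h<length x div 2. if x ! (2 * h) \<noteq> x ! Suc (2 * h) then Bernstein (Suc (Suc (2 * h))) j ?q else 0) =
      p\<^sup>2 * S j + (if 1 \<le> j then 2 * p * ?q * S (j - 1) else 0) + (if 2 \<le> j then ?q\<^sup>2 * S (j - 2) else 0)"
    unfolding B S_def
    by (cases "1 \<le> j"; cases "2 \<le> j")
      (auto simp: sum_distrib_left sum.distrib[symmetric] intro!: sum.cong)
  also have "Bernstein 0 j ?q = (if j = 0 then 1 else 0)"
    by (simp add: Bernstein_def)
  finally have sum: "(\<Sum>h<length (b # c # x) div 2. if (b # c # x) ! (2 * h) \<noteq> (b # c # x) ! Suc (2 * h)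
        then Bernstein (2 * h) j ?q else 0) =
      (if b \<noteq> c then if j = 0 then 1 else 0 else 0) +
      (p\<^sup>2 * S j + (if 1 \<le> j then C * S (j - 1) else 0) + (if 2 \<le> j then ?q\<^sup>2 * S (j - 2) else 0))"
    by (simp only: C_def)
  consider "j = 0" | "j = 1" | i where "j = Suc (Suc i)"
    by (metis One_nat_def not0_implies_Suc)
  then show ?case
    unfolding coin_mass.simps(1) sum C_def[symmetric]
    by cases (use IH in \<open>auto simp: algebra_simps\<close>)
qed simp_all

end

section \<open>Perturbing the alternating string\<close>

definition alternating :: "nat \<Rightarrow> bits" where
  "alternating k = map even [0..<k]"

lemma length_alternating [simp]: "length (alternating k) = k"
  by (simp add: alternating_def)

lemma alternating_0 [simp]: "alternating 0 = []"
  by (simp add: alternating_def)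

lemma alternating_add: "even a \<Longrightarrow> alternating (a + b) = alternating a @ alternating b"
  by (rule nth_equalityI) (auto simp: alternating_def nth_append)

lemma alternating_2: "alternating 2 = [True, False]"
  by (simp add: alternating_def upt_rec)

lemma mix_op_funpow_diff_add:
  assumes "bounded_op 1 S" "0 < r" "r < 1" and F: "\<And>z. \<bar>F z\<bar> \<le> M"
  shows "\<bar>(mix_op r S ^^ (h + c)) F z - (mix_op r S ^^ h) F z\<bar> \<le>
     real c * (sqrt (r / ((1 - r) * (real h + 1))) * M)"
proof (induction c)
  case (Suc c)
  have M: "0 \<le> M" using F[of z] by simp
  have "\<bar>(mix_op r S ^^ Suc (h + c)) F z - (mix_op r S ^^ (h + c)) F z\<bar>
      \<le> sqrt (r / ((1 - r) * (real (h + c) + 1))) * M"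
    by (rule mix_op_funpow_diff) (use assms in auto)
  also have "\<dots> \<le> sqrt (r / ((1 - r) * (real h + 1))) * M"
    using assms(2,3) M by (intro mult_right_mono real_sqrt_le_mono divide_left_mono mult_left_mono mult_pos_pos) auto
  finally show ?case using Suc by (simp add: algebra_simps)
qed simp

text \<open>Coefficients of the polynomial \<open>(1 - w) (1 - w ^ 3) \<dots> (1 - w ^ 3 ^ (m - 1))\<close>. As the exponents
  are odd, the sign of a nonzero coefficient is determined by the parity of its index.\<close>

primrec thue :: "nat \<Rightarrow> nat \<Rightarrow> int" where
  "thue 0 k = (if k = 0 then 1 else 0)"
| "thue (Suc m) k = thue m k - (if 3 ^ m \<le> k then thue m (k - 3 ^ m) else 0)"

lemma thue_eq_0: "3 ^ m \<le> 2 * k \<Longrightarrow> thue m k = 0"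
  by (induction m arbitrary: k) auto

lemma thue_sign: "thue m k = 0 \<or> thue m k = (- 1) ^ k"
proof (induction m arbitrary: k)
  case (Suc m)
  show ?case
  proof (cases "3 ^ m \<le> k")
    case True
    then have "(- 1 :: int) ^ k = (- 1) ^ (k - 3 ^ m) * (- 1) ^ (3 ^ m)"
      by (metis power_add le_add_diff_inverse2)
    moreover have "(- 1 :: int) ^ (3 ^ m) = - 1" by (simp add: minus_one_power_iff)
    ultimately have "(- 1 :: int) ^ k = - ((- 1) ^ (k - 3 ^ m))" by (simp only: mult_minus1_right)
    then show ?thesis using True Suc[of "k - 3 ^ m"] thue_eq_0[of m k] by auto
  qed (use Suc in auto)
qed auto

lemma thue_0_right: "thue m 0 = 1"
  by (induction m) auto

lemma sum_thue_extend:
  fixes f :: "nat \<Rightarrow> real"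
  assumes "3 ^ m \<le> K"
  shows "(\<Sum>k<K. of_int (thue m k) * f k) = (\<Sum>k<3 ^ m. of_int (thue m k) * f k)"
  using assms by (intro sum.mono_neutral_right) (auto simp: thue_eq_0)

lemma sum_thue_Suc:
  fixes f :: "nat \<Rightarrow> real"
  shows "(\<Sum>k<3 ^ Suc m. of_int (thue (Suc m) k) * f k) =
    (\<Sum>k<3 ^ m. of_int (thue m k) * (f k - f (k + 3 ^ m)))"
proof -
  let ?g = "\<lambda>k. if 3 ^ m \<le> k then of_int (thue m (k - 3 ^ m)) * f k else 0"
  have "(\<Sum>k<3 ^ Suc m. ?g k) = (\<Sum>k\<in>{3 ^ m..<3 ^ Suc m}. of_int (thue m (k - 3 ^ m)) * f k)"
    by (intro sum.mono_neutral_cong_right) auto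
  also have "\<dots> = (\<Sum>k\<in>{0 + 3 ^ m..<2 * 3 ^ m + 3 ^ m}. of_int (thue m (k - 3 ^ m)) * f k)"
    by simp
  also have "\<dots> = (\<Sum>k<2 * 3 ^ m. of_int (thue m k) * f (k + 3 ^ m))"
    unfolding sum.shift_bounds_nat_ivl by (simp add: atLeast0LessThan)
  also have "\<dots> = (\<Sum>k<3 ^ m. of_int (thue m k) * f (k + 3 ^ m))"
    by (rule sum_thue_extend) simp
  finally have 1: "(\<Sum>k<3 ^ Suc m. ?g k) = (\<Sum>k<3 ^ m. of_int (thue m k) * f (k + 3 ^ m))" .
  have 2: "(\<Sum>k<3 ^ Suc m. of_int (thue m k) * f k) = (\<Sum>k<3 ^ m. of_int (thue m k) * f k)"
    by (rule sum_thue_extend) simp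
  have "(\<Sum>k<3 ^ Suc m. of_int (thue (Suc m) k) * f k) =
      (\<Sum>k<3 ^ Suc m. of_int (thue m k) * f k) - (\<Sum>k<3 ^ Suc m. ?g k)"
    unfolding sum_subtractf[symmetric] by (intro sum.cong) (auto simp: algebra_simps)
  then show ?thesis unfolding 1 2 by (simp add: right_diff_distrib sum_subtractf)
qed

lemma funpow_commute:
  assumes "\<And>F. A (B F) = B (A F)" shows "(A ^^ a) ((B ^^ b) F) = (B ^^ b) ((A ^^ a) F)"
proof -
  have 1: "A ((B ^^ b) F) = (B ^^ b) (A F)" for F
    by (induction b) (simp_all add: assms)
  show ?thesis by (induction a) (simp_all add: 1)
qed

text \<open>Each factor \<open>B ^ 3 ^ k - A ^ 3 ^ k\<close> of the homogenised polynomial is given its own share \<open>A ^ l B ^ l\<close>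
  of the smoothing.\<close>

lemma sum_thue_mix_op:
  fixes S S' :: "('a \<Rightarrow> real) \<Rightarrow> 'a \<Rightarrow> real" and r :: real
  defines "A \<equiv> mix_op r S" and "B \<equiv> mix_op r S'"
  assumes S: "bounded_op 1 S" "bounded_op 1 S'" and r: "0 < r" "r < 1"
    and comm: "\<And>F. A (B F) = B (A F)"
  assumes "l * m \<le> u" "l * m + 3 ^ m \<le> v" and "\<And>z. \<bar>F z\<bar> \<le> M"
  shows "\<bar>\<Sum>k<3 ^ m. of_int (thue m k) * (A ^^ (u + k)) ((B ^^ (v - k)) F) z\<bar>
    \<le> M * (\<Prod>k<m. 2 * 3 ^ k * sqrt (r / ((1 - r) * (real l + 1))))"
  using assms(8-)
proof (induction m arbitrary: u v F M)
  case 0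
  have AB: "bounded_op 1 A" "bounded_op 1 B"
    unfolding A_def B_def using S r by (auto intro: bounded_op_mix)
  show ?case
    using 0 by (simp add: bounded_op_le1[OF bounded_op_funpow[OF AB(1)]] bounded_op_le1[OF bounded_op_funpow[OF AB(2)]])
next
  case (Suc m)
  let ?d = "sqrt (r / ((1 - r) * (real l + 1)))"
  let ?c = "3 ^ m :: nat"
  have AB: "bounded_op 1 (A ^^ i)" "bounded_op 1 (B ^^ i)" for i
    unfolding A_def B_def using S r by (auto intro!: bounded_op_mix bounded_op_funpow)
  have AA: "(A ^^ i) ((A ^^ j) G) = (A ^^ (i + j)) G" "(B ^^ i) ((B ^^ j) G) = (B ^^ (i + j)) G"
    for i j and G :: "'a \<Rightarrow> real"
    by (simp_all add: funpow_add)
  have BA: "(B ^^ i) ((A ^^ j) G) = (A ^^ j) ((B ^^ i) G)" for i j and G :: "'a \<Rightarrow> real"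
    by (rule funpow_commute) (simp add: comm)
  define G where "G = (\<lambda>z. (A ^^ l) ((B ^^ (l + ?c)) F) z - (A ^^ (l + ?c)) ((B ^^ l) F) z)"
  have G: "\<bar>G z\<bar> \<le> 2 * 3 ^ m * ?d * M" for z
  proof -
    have 1: "\<bar>(B ^^ (l + ?c)) F z - (B ^^ l) F z\<bar> \<le> real ?c * (?d * M)" for z
      unfolding B_def using Suc.prems S r by (intro mix_op_funpow_diff_add)
    have "(A ^^ l) ((B ^^ (l + ?c)) F) z - (A ^^ l) ((B ^^ l) F) z =
        (A ^^ l) (\<lambda>z. (B ^^ (l + ?c)) F z - (B ^^ l) F z) z"
      by (rule bounded_op_diff[OF AB(1), symmetric])
    then have "\<bar>(A ^^ l) ((B ^^ (l + ?c)) F) z - (A ^^ l) ((B ^^ l) F) z\<bar> \<le> real ?c * (?d * M)"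
      using bounded_op_le1[OF AB(1) 1] by simp
    moreover have "\<bar>(A ^^ (l + ?c)) ((B ^^ l) F) z - (A ^^ l) ((B ^^ l) F) z\<bar> \<le> real ?c * (?d * M)"
      unfolding A_def
      by (intro mix_op_funpow_diff_add S r bounded_op_le1[OF AB(2)[unfolded B_def], folded B_def] Suc.prems)
    ultimately show ?thesis unfolding G_def by simp
  qed
  have eq: "(A ^^ (u + k)) ((B ^^ (v - k)) F) z - (A ^^ (u + (k + ?c))) ((B ^^ (v - (k + ?c))) F) z =
      (A ^^ (u - l + k)) ((B ^^ (v - l - ?c - k)) G) z" if "k < ?c" for k
  proof -
    have "u - l + k + l = u + k" "u - l + k + (l + ?c) = u + (k + ?c)"
      "v - l - ?c - k + (l + ?c) = v - k" "v - l - ?c - k + l = v - (k + ?c)"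
      using that Suc.prems by auto
    then show ?thesis
      unfolding G_def
      by (simp only: bounded_op_diff[OF AB(1)] bounded_op_diff[OF AB(2)] BA AA fun_eq_iff
          bounded_op_diff[OF bounded_op_comp1[OF AB(1) AB(2)]])
  qed
  have "(\<Sum>k<3 ^ Suc m. of_int (thue (Suc m) k) * (A ^^ (u + k)) ((B ^^ (v - k)) F) z) =
      (\<Sum>k<3 ^ m. of_int (thue m k) * (A ^^ (u - l + k)) ((B ^^ (v - l - ?c - k)) G) z)"
    unfolding sum_thue_Suc by (intro sum.cong refl) (simp add: eq)
  also have "\<bar>\<dots>\<bar> \<le> (2 * 3 ^ m * ?d * M) * (\<Prod>k<m. 2 * 3 ^ k * ?d)"
    using Suc.prems G by (intro Suc.IH) auto
  finally show ?case by (simp add: mult_ac)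
qed

context deletion_channel
begin

lemma trace_exp_alternating_funpow:
  defines "r \<equiv> 1 - p\<^sup>2"
  defines "W \<equiv> \<lambda>g t. ((1 - p)\<^sup>2 * g (t @ [True, False]) + p * (1 - p) * g (t @ [True])
     + p * (1 - p) * g (t @ [False])) / r"
  shows "bounded_op 1 W" "trace_exp (alternating (2 * h)) g = (mix_op r W ^^ h) g []"
proof -
  have "p\<^sup>2 < 1" using p by (simp add: power_less_one_iff)
  then have r: "0 < r" by (simp add: r_def)
  have "bounded_op (((1 - p)\<^sup>2 * 1 + p * (1 - p) * 1 + p * (1 - p) * 1) / r) W"
  proof -
    have "bounded_op ((1 / r) * ((1 - p)\<^sup>2 * 1 + p * (1 - p) * 1 + p * (1 - p) * 1))
      (\<lambda>g t. (1 / r) * ((1 - p)\<^sup>2 * g (t @ [True, False]) + p * (1 - p) * g (t @ [True])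
         + p * (1 - p) * g (t @ [False])))"
      using p r by (intro bounded_op_scale bounded_op_plus bounded_op_point) auto
    then show ?thesis by (simp add: W_def)
  qed
  moreover have "(1 - p)\<^sup>2 * 1 + p * (1 - p) * 1 + p * (1 - p) * 1 = r"
    by (simp add: r_def power2_eq_square algebra_simps)
  ultimately show "bounded_op 1 W" using r by simp
  show "trace_exp (alternating (2 * h)) g = (mix_op r W ^^ h) g []"
  proof (induction h arbitrary: g)
    case (Suc h)
    have "alternating (2 * Suc h) = alternating (2 * h) @ [True, False]"
      using alternating_add[of "2 * h" 2] by (simp add: alternating_2)
    then have "trace_exp (alternating (2 * Suc h)) g =
        trace_exp (alternating (2 * h)) (\<lambda>t. trace_exp [True, False] (\<lambda>t'. g (t @ t')))"
      by (simp only: trace_exp_append)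
    also have "(\<lambda>t. trace_exp [True, False] (\<lambda>t'. g (t @ t'))) = mix_op r W g"
    proof
      fix t
      have "r * W g t = (1 - p)\<^sup>2 * g (t @ [True, False]) + p * (1 - p) * g (t @ [True])
          + p * (1 - p) * g (t @ [False])"
        using r by (simp add: W_def)
      moreover have "1 - r = p\<^sup>2" by (simp add: r_def)
      ultimately show "trace_exp [True, False] (\<lambda>t'. g (t @ t')) = mix_op r W g t"
        unfolding mix_op_def by (simp only:) (simp add: power2_eq_square algebra_simps)
    qed
    finally show ?case by (simp add: Suc funpow_swap1)
  qed simp
qed

lemma trace_exp_alternating_shift:
  assumes "0 \<le> M" and g: "\<And>t. length t \<le> k + 2 \<Longrightarrow> \<bar>g t\<bar> \<le> M"
  shows "\<bar>trace_exp (alternating (k + 2)) g - trace_exp (alternating k) g\<bar> \<le> 2 * M / (p * sqrt (real k + 1))"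
proof -
  define r where "r = 1 - p\<^sup>2"
  define W where "W = (\<lambda>g t. ((1 - p)\<^sup>2 * g (t @ [True, False]) + p * (1 - p) * g (t @ [True])
     + p * (1 - p) * g (t @ [False])) / r :: real)"
  have "p\<^sup>2 < 1" using p by (simp add: power_less_one_iff)
  then have r: "0 < r" "r < 1" using p by (auto simp: r_def)
  define h where "h = k div 2"
  define f where "f = (\<lambda>t. if length t \<le> k + 2 then g t else 0)"
  define f' where "f' = (\<lambda>t. trace_exp (alternating (k mod 2)) (\<lambda>t'. f (t @ t')))"
  have f': "\<bar>f' t\<bar> \<le> M" for t
    unfolding f'_def by (rule trace_exp_abs_le) (auto simp: f_def g assms(1))
  have k: "k = 2 * h + k mod 2" "k + 2 = 2 * Suc h + k mod 2" by (simp_all add: h_def)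
  have "trace_exp (alternating k) g = trace_exp (alternating k) f"
    by (rule trace_exp_cong_length) (simp add: f_def)
  also have "\<dots> = trace_exp (alternating (2 * h)) f'"
    by (subst k(1), subst alternating_add) (simp_all add: trace_exp_append f'_def)
  also have "\<dots> = (mix_op r W ^^ h) f' []"
    unfolding r_def W_def by (rule trace_exp_alternating_funpow)
  finally have 1: "trace_exp (alternating k) g = (mix_op r W ^^ h) f' []" .
  have "trace_exp (alternating (k + 2)) g = trace_exp (alternating (k + 2)) f"
    by (rule trace_exp_cong_length) (simp add: f_def)
  also have "\<dots> = trace_exp (alternating (2 * Suc h)) f'"
    by (subst k(2), subst alternating_add) (simp_all only: trace_exp_append f'_def dvd_triv_left)
  also have "\<dots> = (mix_op r W ^^ Suc h) f' []"
    unfolding r_def W_def by (rule trace_exp_alternating_funpow)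
  finally have 2: "trace_exp (alternating (k + 2)) g = (mix_op r W ^^ Suc h) f' []" .
  have "bounded_op 1 W"
    unfolding r_def W_def by (rule trace_exp_alternating_funpow)
  from mix_op_funpow_diff[OF this r f']
  have "\<bar>trace_exp (alternating (k + 2)) g - trace_exp (alternating k) g\<bar> \<le>
      sqrt (r / ((1 - r) * (real h + 1))) * M"
    unfolding 1 2 .
  also have "sqrt (r / ((1 - r) * (real h + 1))) \<le> sqrt (1 / (p\<^sup>2 * ((real k + 1) / 4)))"
  proof (intro real_sqrt_le_mono frac_le)
    have "real k \<le> 2 * real h + 1"
    proof -
      have "k \<le> 2 * h + 1" unfolding h_def by linarith
      then have "real k \<le> real (2 * h + 1)" by (simp only: of_nat_le_iff)
      then show ?thesis by simp
    qed
    then show "p\<^sup>2 * ((real k + 1) / 4) \<le> (1 - r) * (real h + 1)"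
      unfolding r_def by (intro mult_mono) auto
  qed (use p r in auto)
  also have "\<dots> = 2 / (p * sqrt (real k + 1))"
    using p by (simp add: real_sqrt_divide real_sqrt_mult)
  finally show ?thesis using assms(1) by (simp add: mult_right_mono)
qed

definition flip_effect :: "nat \<Rightarrow> nat \<Rightarrow> (bits \<Rightarrow> real) \<Rightarrow> real" where
  "flip_effect n k g = (1 - p) * trace_exp (replicate k False) (\<lambda>u.
     trace_exp (replicate (n - 1 - k) False) (\<lambda>v. g (u @ True # v) - g (u @ False # v)))"

lemma flip_effect_0: "flip_effect (Suc n) 0 g =
  (1 - p) * (trace_exp (replicate n False) (\<lambda>v. g (True # v)) - trace_exp (replicate n False) (\<lambda>v. g (False # v)))"
  by (simp add: flip_effect_def trace_exp_diff)

lemma flip_effect_Suc: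
  "flip_effect (Suc n) (Suc k) g = p * flip_effect n k g + (1 - p) * flip_effect n k (\<lambda>t. g (False # t))"
  by (simp add: flip_effect_def algebra_simps)

lemma trace_exp_zero_diff:
  assumes "0 \<le> B"
    and "\<And>u v. length u + length v + 1 \<le> length c \<Longrightarrow> \<bar>g (u @ True # v) - g (u @ False # v)\<bar> \<le> B"
  shows "\<bar>trace_exp c g - trace_exp (replicate (length c) False) g\<bar> \<le> real (length c) * B"
  using assms(2)
proof (induction c arbitrary: g)
  case (Cons b c)
  let ?Z = "replicate (length c) False"
  let ?g = "\<lambda>b t. g (b # t)"
  have 1: "\<bar>trace_exp c g - trace_exp ?Z g\<bar> \<le> real (length c) * B"
    by (rule Cons.IH, rule Cons.prems) simp
  have 2: "\<bar>trace_exp c (?g False) - trace_exp ?Z (?g False)\<bar> \<le> real (length c) * B"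
    by (rule Cons.IH, subst append_Cons[symmetric], subst append_Cons[symmetric], rule Cons.prems) simp
  have "\<bar>trace_exp c (\<lambda>t. ?g True t - ?g False t)\<bar> \<le> B"
    using Cons.prems[of "[]"] by (intro trace_exp_abs_le) auto
  then have 3: "\<bar>trace_exp c (?g b) - trace_exp c (?g False)\<bar> \<le> B"
    using assms(1) by (cases b) (auto simp: trace_exp_diff)
  have "trace_exp (b # c) g - trace_exp (replicate (length (b # c)) False) g =
      p * (trace_exp c g - trace_exp ?Z g) + (1 - p) * ((trace_exp c (?g False) - trace_exp ?Z (?g False))
      + (trace_exp c (?g b) - trace_exp c (?g False)))"
    by (simp add: algebra_simps)
  also have "\<bar>\<dots>\<bar> \<le> p * (real (length c) * B + B) + (1 - p) * (real (length c) * B + B)"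
    using p 1 2 3 assms(1)
    by (intro order_trans[OF abs_triangle_ineq] add_mono) (auto simp: abs_mult intro!: mult_left_mono)
  also have "\<dots> = real (length (b # c)) * B" by (simp add: algebra_simps)
  finally show ?case .
qed simp

lemma trace_exp_taylor:
  assumes "0 \<le> B"
    and "\<And>u v w. length u + length v + length w + 2 \<le> length c \<Longrightarrow>
       \<bar>g (u @ True # v @ True # w) - g (u @ True # v @ False # w)
        - (g (u @ False # v @ True # w) - g (u @ False # v @ False # w))\<bar> \<le> B"
  shows "\<bar>trace_exp c g - trace_exp (replicate (length c) False) g
      - (\<Sum>k<length c. of_bool (c ! k) * flip_effect (length c) k g)\<bar> \<le> (real (length c))\<^sup>2 * B"
  using assms(2)
proof (induction c arbitrary: g)
  case (Cons b c)
  let ?n = "length c"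
  let ?Z = "replicate ?n False"
  let ?g = "\<lambda>b t. g (b # t)"
  let ?e = "\<lambda>g. trace_exp c g - trace_exp ?Z g - (\<Sum>k<?n. of_bool (c ! k) * flip_effect ?n k g)"
  let ?d = "\<lambda>t. ?g True t - ?g False t"
  have 1: "\<bar>?e g\<bar> \<le> (real ?n)\<^sup>2 * B"
    by (rule Cons.IH, rule Cons.prems) simp
  have 2: "\<bar>?e (?g False)\<bar> \<le> (real ?n)\<^sup>2 * B"
  proof (rule Cons.IH)
    fix u v w :: bits assume "length u + length v + length w + 2 \<le> length c"
    then show "\<bar>?g False (u @ True # v @ True # w) - ?g False (u @ True # v @ False # w)
        - (?g False (u @ False # v @ True # w) - ?g False (u @ False # v @ False # w))\<bar> \<le> B"
      using Cons.prems[of "False # u" v w] by simp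
  qed
  have 3: "\<bar>trace_exp c ?d - trace_exp ?Z ?d\<bar> \<le> real ?n * B"
  proof (rule trace_exp_zero_diff[OF assms(1)])
    fix u v :: bits assume "length u + length v + 1 \<le> length c"
    then show "\<bar>?d (u @ True # v) - ?d (u @ False # v)\<bar> \<le> B"
      using Cons.prems[of "[]" u v] by simp
  qed
  have "(\<Sum>k<length (b # c). of_bool ((b # c) ! k) * flip_effect (length (b # c)) k g) =
      of_bool b * ((1 - p) * trace_exp ?Z ?d)
      + p * (\<Sum>k<?n. of_bool (c ! k) * flip_effect ?n k g)
      + (1 - p) * (\<Sum>k<?n. of_bool (c ! k) * flip_effect ?n k (?g False))"
    unfolding length_Cons sum.lessThan_Suc_shift flip_effect_0 flip_effect_Suc trace_exp_diff
    by (simp only: nth_Cons_0 nth_Cons_Suc distrib_left sum.distrib sum_distrib_left mult_ac add_ac)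
  then have "trace_exp (b # c) g - trace_exp (replicate (length (b # c)) False) g
      - (\<Sum>k<length (b # c). of_bool ((b # c) ! k) * flip_effect (length (b # c)) k g) =
      p * ?e g + (1 - p) * (?e (?g False) + of_bool b * (trace_exp c ?d - trace_exp ?Z ?d))"
    by (cases b) (simp_all add: trace_exp_diff algebra_simps)
  also have "\<bar>\<dots>\<bar> \<le> p * ((real ?n)\<^sup>2 * B + real ?n * B) + (1 - p) * ((real ?n)\<^sup>2 * B + real ?n * B)"
  proof -
    have "\<bar>?e g\<bar> \<le> (real ?n)\<^sup>2 * B + real ?n * B"
      using 1 assms(1) by (smt (verit) mult_nonneg_nonneg of_nat_0_le_iff)
    moreover have "\<bar>of_bool b * (trace_exp c ?d - trace_exp ?Z ?d)\<bar> \<le> real ?n * B"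
      using 3 assms(1) by (cases b) simp_all
    then have "\<bar>?e (?g False) + of_bool b * (trace_exp c ?d - trace_exp ?Z ?d)\<bar> \<le> (real ?n)\<^sup>2 * B + real ?n * B"
      using 2 by linarith
    ultimately show ?thesis
      using p by (intro order_trans[OF abs_triangle_ineq] add_mono) (simp_all add: abs_mult mult_left_mono)
  qed
  also have "\<dots> = ((real ?n)\<^sup>2 + real ?n) * B" by (simp add: algebra_simps)
  also have "\<dots> \<le> (real (length (b # c)))\<^sup>2 * B"
    using assms(1) by (intro mult_right_mono) (auto simp: power2_eq_square algebra_simps)
  finally show ?case .
qed simp

end

section \<open>The two strings\<close>

definition pattern :: "nat \<Rightarrow> nat \<Rightarrow> bits" where
  "pattern m L = map (\<lambda>k. even k \<noteq> (L \<le> k \<and> thue m (k - L) \<noteq> 0)) [0..<3 * L]"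

lemma length_pattern [simp]: "length (pattern m L) = 3 * L"
  by (simp add: pattern_def)

lemma of_bool_pattern:
  assumes "even L" "k < 3 * L"
  shows "of_bool (pattern m L ! k) =
     (of_bool (alternating (3 * L) ! k) - (if L \<le> k then of_int (thue m (k - L)) else 0) :: real)"
  using assms thue_sign[of m "k - L"]
  by (auto simp: pattern_def alternating_def minus_one_power_iff split: if_splits)

definition late_string :: "nat \<Rightarrow> nat \<Rightarrow> nat \<Rightarrow> nat \<Rightarrow> bits" where
  "late_string m L a b = alternating (a + 2) @ pattern m L @ alternating b"

definition early_string :: "nat \<Rightarrow> nat \<Rightarrow> nat \<Rightarrow> nat \<Rightarrow> bits" where
  "early_string m L a b = alternating a @ pattern m L @ alternating (b + 2)"

lemma length_strings [simp]:
  "length (late_string m L a b) = a + 2 + 3 * L + b"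
  "length (early_string m L a b) = a + 2 + 3 * L + b"
  by (simp_all add: late_string_def early_string_def)

lemma late_string_neq_early_string:
  assumes "even a" "even L" "2 \<le> L"
  shows "late_string m L a b \<noteq> early_string m L a b"
proof -
  have "late_string m L a b ! (a + L) = pattern m L ! (L - 2)"
    using assms less_le_trans[of "L - 2" L "3 * L"] by (simp add: late_string_def nth_append)
  moreover have "pattern m L ! (L - 2)"
    using assms less_le_trans[of "L - 2" L "3 * L"] by (simp add: pattern_def)
  moreover have "early_string m L a b ! (a + L) = pattern m L ! L"
    using assms by (simp add: early_string_def nth_append)
  moreover have "\<not> pattern m L ! L"
    using assms by (simp add: pattern_def thue_0_right)
  ultimately show ?thesis by metis
qed

lemma edit_distance_strings:
  assumes "even a" shows "edit_distance (late_string m L a b) (early_string m L a b) \<le> 4"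
proof -
  let ?A = "alternating a" and ?P = "pattern m L" and ?B = "alternating b"
  have late: "late_string m L a b = ?A @ True # False # ?P @ ?B"
    using alternating_add[OF assms, of 2] by (simp add: late_string_def alternating_2)
  have "alternating (b + 2) = True # False # ?B"
    using alternating_add[of 2 b] by (simp add: alternating_2 add.commute)
  then have early: "early_string m L a b = ?A @ ?P @ True # False # ?B"
    by (simp add: early_string_def)
  have "edit_step (late_string m L a b) (?A @ False # ?P @ ?B)"
    unfolding late by (rule deletion)
  moreover have "edit_step (?A @ False # ?P @ ?B) (?A @ ?P @ ?B)"
    by (rule deletion)
  moreover have "edit_step (?A @ ?P @ ?B) (?A @ ?P @ False # ?B)"
    using insertion[of "?A @ ?P" ?B False] by simp
  moreover have "edit_step (?A @ ?P @ False # ?B) (early_string m L a b)"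
    unfolding early using insertion[of "?A @ ?P" "False # ?B" True] by simp
  ultimately have "(edit_step ^^ Suc (Suc (Suc (Suc 0)))) (late_string m L a b) (early_string m L a b)"
    by (auto intro!: relcomppI)
  moreover have four: "(4 :: nat) = Suc (Suc (Suc (Suc 0)))" by simp
  ultimately have "(edit_step ^^ 4) (late_string m L a b) (early_string m L a b)"
    by (simp only: four)
  then show ?thesis unfolding edit_distance_def by (rule Least_le)
qed

context deletion_channel
begin

lemma trace_exp_replicate:
  "trace_exp (replicate k False) g = trace_exp (replicate k False) (\<lambda>t. g (replicate (length t) False))"
proof (induction k arbitrary: g)
  case (Suc k)
  show ?case
    using Suc[of g] Suc[of "\<lambda>t. g (False # t)"] by simp
qed simp

lemma funpow_fst_eq_trace_exp:
  "(mix_op (1 - p) (\<lambda>G z. G (Suc (fst z), snd z)) ^^ k) G (i, j) =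
     trace_exp (replicate k False) (\<lambda>t. G (i + length t, j))"
  by (induction k arbitrary: i) (simp_all add: mix_op_def)

lemma funpow_snd_eq_trace_exp:
  "(mix_op (1 - p) (\<lambda>G z. G (fst z, Suc (snd z))) ^^ k) G (i, j) =
     trace_exp (replicate k False) (\<lambda>t. G (i, j + length t))"
  by (induction k arbitrary: j) (simp_all add: mix_op_def)

lemma flip_effect_eq_funpow:
  "flip_effect n k g = (1 - p) *
     (mix_op (1 - p) (\<lambda>G z. G (Suc (fst z), snd z)) ^^ k)
       ((mix_op (1 - p) (\<lambda>G z. G (fst z, Suc (snd z))) ^^ (n - 1 - k))
         (\<lambda>z. g (replicate (fst z) False @ True # replicate (snd z) False)
            - g (replicate (fst z) False @ False # replicate (snd z) False))) (0, 0)"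
  unfolding funpow_fst_eq_trace_exp funpow_snd_eq_trace_exp flip_effect_def
  by (subst trace_exp_replicate, subst trace_exp_replicate[of "n - 1 - k"]) simp

lemma linear_part_le:
  assumes "even L" "l * m \<le> L" "l * m + 3 ^ m < 2 * L" and g: "\<And>t. \<bar>g t\<bar> \<le> M"
  shows "\<bar>(\<Sum>k<3 * L. of_bool (pattern m L ! k) * flip_effect (3 * L) k g)
      - (\<Sum>k<3 * L. of_bool (alternating (3 * L) ! k) * flip_effect (3 * L) k g)\<bar>
    \<le> 2 * M * (\<Prod>k<m. 2 * 3 ^ k * sqrt ((1 - p) / (p * (real l + 1))))"
proof -
  let ?S = "\<lambda>(G :: nat \<times> nat \<Rightarrow> real) z. G (Suc (fst z), snd z)"
  let ?S' = "\<lambda>(G :: nat \<times> nat \<Rightarrow> real) z. G (fst z, Suc (snd z))"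
  let ?G = "\<lambda>z. g (replicate (fst z) False @ True # replicate (snd z) False)
            - g (replicate (fst z) False @ False # replicate (snd z) False)"
  let ?A = "mix_op (1 - p) ?S" and ?B = "mix_op (1 - p) ?S'"
  let ?f = "\<lambda>k. flip_effect (3 * L) k g"
  have "(\<Sum>k<3 * L. of_bool (pattern m L ! k) * ?f k) - (\<Sum>k<3 * L. of_bool (alternating (3 * L) ! k) * ?f k)
      = (\<Sum>k<3 * L. if L \<le> k then - (of_int (thue m (k - L)) * ?f k) else 0)"
    unfolding sum_subtractf[symmetric]
    by (intro sum.cong refl) (simp add: of_bool_pattern[OF assms(1)] left_diff_distrib del: of_bool_eq_iff)
  also have "\<dots> = (\<Sum>k\<in>{0 + L..<2 * L + L}. - (of_int (thue m (k - L)) * ?f k))"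
    by (intro sum.mono_neutral_cong_right) auto
  also have "\<dots> = - (\<Sum>k<2 * L. of_int (thue m k) * ?f (L + k))"
    unfolding sum.shift_bounds_nat_ivl by (simp add: atLeast0LessThan sum_negf add.commute)
  also have "(\<Sum>k<2 * L. of_int (thue m k) * ?f (L + k)) = (\<Sum>k<3 ^ m. of_int (thue m k) * ?f (L + k))"
    using assms(3) by (intro sum_thue_extend) linarith
  also have "\<dots> = (1 - p) * (\<Sum>k<3 ^ m. of_int (thue m k) * (?A ^^ (L + k)) ((?B ^^ (2 * L - 1 - k)) ?G) (0, 0))"
  proof -
    have "3 * L - 1 - (L + k) = 2 * L - 1 - k" for k by simp
    then show ?thesis
      unfolding flip_effect_eq_funpow sum_distrib_left by (intro sum.cong refl) (simp only: mult_ac)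
  qed
  finally have eq: "(\<Sum>k<3 * L. of_bool (pattern m L ! k) * ?f k)
      - (\<Sum>k<3 * L. of_bool (alternating (3 * L) ! k) * ?f k) =
    - ((1 - p) * (\<Sum>k<3 ^ m. of_int (thue m k) * (?A ^^ (L + k)) ((?B ^^ (2 * L - 1 - k)) ?G) (0, 0)))" .
  have "\<bar>\<Sum>k<3 ^ m. of_int (thue m k) * (?A ^^ (L + k)) ((?B ^^ (2 * L - 1 - k)) ?G) (0, 0)\<bar>
      \<le> 2 * M * (\<Prod>k<m. 2 * 3 ^ k * sqrt ((1 - p) / ((1 - (1 - p)) * (real l + 1))))" (is "\<bar>?X\<bar> \<le> ?Y")
  proof (rule sum_thue_mix_op[where S = ?S and S' = ?S' and r = "1 - p" and l = l and F = ?G])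
    show "\<bar>?G z\<bar> \<le> 2 * M" for z
      using g[of "replicate (fst z) False @ True # replicate (snd z) False"]
        g[of "replicate (fst z) False @ False # replicate (snd z) False"] by linarith
    show "?A (?B F) = ?B (?A F)" for F
      by (simp add: mix_op_def fun_eq_iff algebra_simps)
    show "bounded_op 1 ?S" "bounded_op 1 ?S'" by (rule bounded_op_point)+
    show "l * m + 3 ^ m \<le> 2 * L - 1" using assms(3) by linarith
    show "l * m \<le> L" by fact
    show "0 < 1 - p" "1 - p < 1" using p by auto
  qed
  then have "\<bar>- ((1 - p) * ?X)\<bar> \<le> 1 * ?Y"
    unfolding abs_minus_cancel abs_mult using p by (intro mult_mono) auto
  then show ?thesis unfolding eq by simp
qed

lemma trace_op_strings_diff:
  assumes even: "even a" "even L" and lm: "l * m \<le> L" "l * m + 3 ^ m < 2 * L" and "a \<le> b"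
    and F: "\<And>s. \<bar>F s\<bar> \<le> 1" and "0 \<le> B"
    and B: "\<And>i j s. i < j \<Longrightarrow> j < a + 2 + 3 * L \<Longrightarrow> \<bar>delta i (delta j F) s\<bar> \<le> B"
  shows "\<bar>trace_op (late_string m L a b) 0 F s - trace_op (early_string m L a b) 0 F s\<bar>
    \<le> 4 * (\<Prod>k<m. 2 * 3 ^ k * sqrt ((1 - p) / (p * (real l + 1))))
      + 8 * (real (3 * L))\<^sup>2 * B / (p * sqrt (real a + 1))"
proof -
  let ?N = "3 * L"
  define \<tau> where "\<tau> = 2 * (\<Prod>k<m. 2 * 3 ^ k * sqrt ((1 - p) / (p * (real l + 1))))"
  define C where "C = 2 * ((real ?N)\<^sup>2 * B)"
  define g where "g t = F (add_bits t 0 s)" for t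
  define H where "H c t1 t2 = trace_exp c (\<lambda>t. g (t1 @ t @ t2))" for c t1 t2
  define lin where "lin c t1 t2 = (\<Sum>k<?N. of_bool (c ! k) * flip_effect ?N k (\<lambda>t. g (t1 @ t @ t2)))"
    for c t1 t2
  define T where "T t1 t2 = lin (pattern m L) t1 t2 - lin (alternating ?N) t1 t2" for t1 t2
  define R where "R t1 t2 = H (pattern m L) t1 t2 - H (alternating ?N) t1 t2 - T t1 t2" for t1 t2
  let ?E = "\<lambda>i j f. trace_exp (alternating i) (\<lambda>t1. trace_exp (alternating j) (f t1))"
  have EH: "trace_exp (alternating i @ c @ alternating j) g = ?E i j (H c)" for i j c
    by (simp add: trace_exp_append H_def[abs_def] trace_exp_swap[of c])
  have T: "\<bar>T t1 t2\<bar> \<le> \<tau>" for t1 t2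
  proof -
    have "\<bar>g t\<bar> \<le> 1" for t by (simp add: g_def F)
    then show ?thesis
      unfolding T_def lin_def \<tau>_def using linear_part_le[OF even(2) lm, of "\<lambda>t. g (t1 @ t @ t2)" 1] by simp
  qed
  have R: "\<bar>R t1 t2\<bar> \<le> C" if t1: "length t1 \<le> a + 2" for t1 t2
  proof -
    have *: "\<bar>H c t1 t2 - H (replicate ?N False) t1 t2 - lin c t1 t2\<bar> \<le> (real ?N)\<^sup>2 * B" if c: "length c = ?N" for c
    proof -
      have "\<bar>g (t1 @ (u @ True # v @ True # w) @ t2) - g (t1 @ (u @ True # v @ False # w) @ t2)
          - (g (t1 @ (u @ False # v @ True # w) @ t2) - g (t1 @ (u @ False # v @ False # w) @ t2))\<bar> \<le> B"
        if len: "length u + length v + length w + 2 \<le> length c" for u v w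
      proof -
        define i where "i = length t1 + length u"
        define j where "j = i + Suc (length v)"
        define s' where "s' = add_bits (t1 @ u @ False # v @ False # w @ t2) 0 s"
        have "g (t1 @ (u @ b # v @ c # w) @ t2) = F (bump i b (bump j c s'))" for b c
        proof -
          have "add_bits (t1 @ (u @ b # v @ c # w) @ t2) 0 s =
              bump i b (add_bits ((t1 @ u @ False # v) @ c # (w @ t2)) 0 s)"
            using add_bits_append_bit[of "t1 @ u" b "v @ c # w @ t2" 0 s] by (simp add: i_def)
          also have "add_bits ((t1 @ u @ False # v) @ c # (w @ t2)) 0 s = bump j c s'"
            by (subst add_bits_append_bit) (simp add: j_def i_def s'_def add.assoc)
          finally show ?thesis by (simp add: g_def)
        qed
        moreover have "\<bar>delta i (delta j F) s'\<bar> \<le> B"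
          using len t1 c by (intro B) (auto simp: i_def j_def)
        ultimately show ?thesis
          by (simp only: delta_def translation_def bump_commute[of j True i True] bump_False)
      qed
      from trace_exp_taylor[OF \<open>0 \<le> B\<close>, of c "\<lambda>t. g (t1 @ t @ t2)", OF this] show ?thesis
        by (simp only: H_def lin_def c)
    qed
    show ?thesis
      unfolding R_def T_def C_def
      using *[OF length_pattern[of m L]] *[OF length_alternating[of ?N]] by linarith
  qed
  have C: "0 \<le> C" using \<open>0 \<le> B\<close> by (simp add: C_def)
  have "?E (a + 2) b (H (alternating ?N)) = ?E a (b + 2) (H (alternating ?N))"
  proof -
    have e: "even (a + 2)" "even ?N" using even by simp_all
    have "alternating (a + 2) @ alternating ?N @ alternating b = alternating (a + (2 + (?N + b)))"
      using alternating_add[OF e(1), of "?N + b"] alternating_add[OF e(2), of b] by (simp only: add.assoc)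
    moreover have "alternating a @ alternating ?N @ alternating (b + 2) = alternating (a + (?N + (b + 2)))"
      using alternating_add[OF even(1), of "?N + (b + 2)"] alternating_add[OF e(2), of "b + 2"] by (simp only: add.assoc)
    moreover have "a + (2 + (?N + b)) = a + (?N + (b + 2))" by simp
    ultimately show ?thesis unfolding EH[symmetric] by (simp only:)
  qed
  moreover have "?E i j (H (pattern m L)) = ?E i j (H (alternating ?N)) + ?E i j T + ?E i j R" for i j
    unfolding trace_exp_add[symmetric] by (simp add: R_def)
  ultimately have "trace_op (late_string m L a b) 0 F s - trace_op (early_string m L a b) 0 F s =
      (?E (a + 2) b T - ?E a (b + 2) T) + (?E (a + 2) b R - ?E a (b + 2) R)"
    unfolding trace_op_def late_string_def early_string_def g_def[symmetric] EH by simp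
  moreover have "\<bar>?E (a + 2) b T - ?E a (b + 2) T\<bar> \<le> 2 * \<tau>"
  proof -
    have "\<bar>?E i j T\<bar> \<le> \<tau>" for i j
      by (intro trace_exp_abs_le T)
    from this[of "a + 2" b] this[of a "b + 2"] show ?thesis by linarith
  qed
  moreover have "\<bar>?E (a + 2) b R - ?E a (b + 2) R\<bar> \<le> 2 * (2 * C / (p * sqrt (real a + 1)))"
  proof -
    have "\<bar>?E (a + 2) b R - ?E a b R\<bar> \<le> 2 * C / (p * sqrt (real a + 1))"
      by (intro trace_exp_alternating_shift trace_exp_abs_le C R)
    moreover have "\<bar>?E a (b + 2) R - ?E a b R\<bar> \<le> 2 * C / (p * sqrt (real a + 1))"
      unfolding trace_exp_diff[symmetric]
    proof (rule trace_exp_abs_le)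
      fix t1 :: bits assume "length t1 \<le> length (alternating a)"
      then have "\<bar>trace_exp (alternating (b + 2)) (R t1) - trace_exp (alternating b) (R t1)\<bar>
          \<le> 2 * C / (p * sqrt (real b + 1))"
        by (intro trace_exp_alternating_shift C R) simp
      also have "\<dots> \<le> 2 * C / (p * sqrt (real a + 1))"
        using C p \<open>a \<le> b\<close> by (intro divide_left_mono mult_left_mono mult_pos_pos) auto
      finally show "\<bar>trace_exp (alternating (b + 2)) (R t1) - trace_exp (alternating b) (R t1)\<bar>
          \<le> 2 * C / (p * sqrt (real a + 1))" .
    qed
    ultimately show ?thesis by linarith
  qed
  ultimately have "\<bar>trace_op (late_string m L a b) 0 F s - trace_op (early_string m L a b) 0 F s\<bar>
      \<le> 2 * \<tau> + 2 * (2 * C / (p * sqrt (real a + 1)))"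
    by linarith
  also have "2 * \<tau> + 2 * (2 * C / (p * sqrt (real a + 1))) =
      4 * (\<Prod>k<m. 2 * 3 ^ k * sqrt ((1 - p) / (p * (real l + 1))))
      + 8 * (real (3 * L))\<^sup>2 * B / (p * sqrt (real a + 1))"
    unfolding \<tau>_def C_def by simp
  finally show ?thesis .
qed

end

section \<open>Smoothness of iterated trace operators\<close>

lemma sum_Bernstein_column:
  "x * (\<Sum>k<n. Bernstein k j x) = 1 - (\<Sum>i\<le>j. Bernstein n i x)"
proof (induction n)
  case 0
  have "(\<Sum>i\<le>j. Bernstein 0 i x) = Bernstein 0 0 x"
    by (rule sum.mono_neutral_cong_right[of _ "{0}" _ "\<lambda>_. Bernstein 0 0 x", simplified]) (auto simp: Bernstein_def)
  then show ?case by (simp add: Bernstein_def)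
next
  case (Suc n)
  have "(\<Sum>i\<le>j. Bernstein (Suc n) i x) = (\<Sum>i\<le>j. Bernstein n i x) - x * Bernstein n j x"
    by (induction j) (simp_all add: Bernstein_Suc_0 Bernstein_Suc_Suc algebra_simps)
  then show ?case using Suc by (simp add: algebra_simps)
qed

lemma sum_Bernstein_lower_tail:
  assumes "0 < x" "x \<le> 1" "0 < n" "2 * real j \<le> real n * x"
  shows "(\<Sum>i\<le>j. Bernstein n i x) \<le> 4 / (real n * x)"
proof -
  have nx: "0 < real n * x" using assms by simp
  have "j \<le> n"
  proof -
    have "real n * x \<le> real n" using assms by (simp add: mult_left_le)
    then show ?thesis using assms(4) by linarith
  qed
  have "(real n * x)\<^sup>2 / 4 * (\<Sum>i\<le>j. Bernstein n i x) \<le> (\<Sum>i\<le>j. Bernstein n i x * (real i - real n * x)\<^sup>2)"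
    unfolding sum_distrib_left
  proof (rule sum_mono)
    fix i assume "i \<in> {..j}"
    then have "real i \<le> real j" by simp
    then have "real n * x / 2 \<le> real n * x - real i" using assms(4) by linarith
    then have "(real n * x / 2)\<^sup>2 \<le> (real n * x - real i)\<^sup>2"
      using nx by (intro power_mono) auto
    then have "(real n * x)\<^sup>2 / 4 \<le> (real i - real n * x)\<^sup>2"
      by (simp add: power_divide power2_commute)
    then show "(real n * x)\<^sup>2 / 4 * Bernstein n i x \<le> Bernstein n i x * (real i - real n * x)\<^sup>2"
      using assms by (subst mult.commute, intro mult_left_mono Bernstein_nonneg) auto
  qed
  also have "\<dots> \<le> (\<Sum>i\<le>n. Bernstein n i x * (real i - real n * x)\<^sup>2)"
    using assms \<open>j \<le> n\<close> by (intro sum_mono2) (auto simp: Bernstein_nonneg)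
  also have "\<dots> \<le> real n * x"
    unfolding Bernstein_variance using nx assms by (simp add: mult_left_le)
  finally have "real n * x * (real n * x / 4 * (\<Sum>i\<le>j. Bernstein n i x)) \<le> real n * x * 1"
    by (simp add: power2_eq_square mult_ac)
  then have "real n * x / 4 * (\<Sum>i\<le>j. Bernstein n i x) \<le> 1"
    using nx by (simp only: mult_le_cancel_left_pos)
  then show ?thesis using nx by (simp add: field_simps)
qed

lemma sum_even_Bernstein_ge:
  assumes p: "0 < p" "p < 1" and e: "8 \<le> real (2 * e) * (1 - p)" "2 * real j \<le> real (2 * e) * (1 - p)"
  shows "p / 4 - 1 / sqrt (p * (1 - p) * (real (2 * e) + 1)) \<le> (\<Sum>h<e. Bernstein (2 * h) j (1 - p))"
proof -
  let ?b = "\<lambda>k. Bernstein k j (1 - p)"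
  have "0 < e" using e(1) by (cases e) auto
  then have "(\<Sum>i\<le>j. Bernstein (2 * e) i (1 - p)) \<le> 4 / (real (2 * e) * (1 - p))"
    using p e by (intro sum_Bernstein_lower_tail) auto
  also have "\<dots> \<le> 4 / 8"
    using e(1) by (intro divide_left_mono) auto
  finally have "1 / 2 \<le> (1 - p) * (\<Sum>k<2 * e. ?b k)"
    unfolding sum_Bernstein_column by simp
  also have "\<dots> \<le> 1 * (\<Sum>k<2 * e. ?b k)"
    using p by (intro mult_right_mono sum_nonneg) (auto simp: Bernstein_nonneg)
  also have "(\<Sum>k<2 * e. ?b k) = (\<Sum>h<e. ?b (2 * h)) + (\<Sum>h<e. ?b (Suc (2 * h)))"
    by (induction e) (simp_all add: algebra_simps)
  finally have 1: "1 / 2 \<le> (\<Sum>h<e. ?b (2 * h)) + (\<Sum>h<e. ?b (Suc (2 * h)))" by simp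
  have "p * (\<Sum>h<e. ?b (Suc (2 * h))) \<le> (\<Sum>h<e. ?b (2 * Suc h))"
    unfolding sum_distrib_left
  proof (rule sum_mono)
    fix h
    show "p * ?b (Suc (2 * h)) \<le> ?b (2 * Suc h)"
      using p by (cases j) (simp_all add: Bernstein_Suc_0 Bernstein_Suc_Suc[of "Suc (2 * h)"] Bernstein_nonneg)
  qed
  also have "\<dots> = (\<Sum>h<Suc e. ?b (2 * h)) - ?b 0"
    unfolding sum.lessThan_Suc_shift by simp
  also have "\<dots> \<le> (\<Sum>h<e. ?b (2 * h)) + ?b (2 * e)"
    using p Bernstein_nonneg[of "1 - p" 0 j] by simp
  finally have 2: "p * (\<Sum>h<e. ?b (Suc (2 * h))) \<le> (\<Sum>h<e. ?b (2 * h)) + ?b (2 * e)" .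
  have 3: "?b (2 * e) \<le> 1 / sqrt (p * (1 - p) * (real (2 * e) + 1))"
    using Bernstein_le_sqrt[of "1 - p" "2 * e" j] p by (simp add: mult_ac)
  have "0 \<le> (\<Sum>h<e. ?b (2 * h))"
    using p by (intro sum_nonneg) (simp add: Bernstein_nonneg)
  then have "p * (\<Sum>h<e. ?b (2 * h)) \<le> (\<Sum>h<e. ?b (2 * h))"
    using p by (simp add: mult_left_le_one_le)
  moreover have "p * (1 / 2) \<le> p * ((\<Sum>h<e. ?b (2 * h)) + (\<Sum>h<e. ?b (Suc (2 * h))))"
    using 1 p by (intro mult_left_mono) auto
  moreover have "0 \<le> ?b (2 * e)" using p by (simp add: Bernstein_nonneg)
  ultimately show ?thesis using 2 3 by (simp add: distrib_left)
qed

lemma alternating_append_alternates: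
  assumes "even a" "even (length c)" "2 * h + 1 < a + length c + b" "2 * h < a \<or> a + length c \<le> 2 * h"
  shows "(alternating a @ c @ alternating b) ! (2 * h) \<noteq> (alternating a @ c @ alternating b) ! Suc (2 * h)"
proof (cases "2 * h < a")
  case True
  then have "Suc (2 * h) < a" using assms(1) by presburger
  then show ?thesis by (simp add: nth_append alternating_def)
next
  case False
  then obtain i where i: "2 * h = (a + length c) + i" using assms(4) le_Suc_ex by blast
  then have "even i" using assms(1,2) by presburger
  have "(alternating a @ c @ alternating b) ! (a + length c + k) = alternating b ! k" for k
    using nth_append_length_plus[of "alternating a @ c" "alternating b" k] by simp
  from this[of i] this[of "Suc i"] show ?thesis
    using assms(3) i \<open>even i\<close> by (simp add: alternating_def)
qed

context deletion_channel
begin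

lemma coin_mass_ge:
  assumes x: "\<And>h. h < length x div 2 \<Longrightarrow> 2 * h < a \<or> a + K \<le> 2 * h \<Longrightarrow> x ! (2 * h) \<noteq> x ! Suc (2 * h)"
    and a: "a \<le> 2 * (length x div 2)"
    and "8 \<le> real (2 * (length x div 2)) * (1 - p)" "2 * real j \<le> real (2 * (length x div 2)) * (1 - p)"
  shows "2 * p * (1 - p) * (p / 4 - (real K + 1) / sqrt (p * (1 - p) * (real a + 1))) \<le> coin_mass x j"
proof -
  let ?e = "length x div 2"
  let ?b = "\<lambda>h. Bernstein (2 * h) j (1 - p)"
  let ?r = "\<lambda>n. 1 / sqrt (p * (1 - p) * (real n + 1))"
  let ?bad = "{h. a \<le> 2 * h \<and> 2 * h < a + K}"
  have r: "?r n \<le> ?r a" if "a \<le> n" for n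
    using that p by (intro divide_left_mono real_sqrt_le_mono mult_left_mono mult_pos_pos) auto
  have fin: "finite ?bad" by (rule finite_subset[of _ "{..<a + K}"]) auto
  have "card ?bad \<le> card {a..<a + K}"
    by (rule card_inj_on_le[of "\<lambda>h. 2 * h"]) (auto simp: inj_on_def)
  then have card: "card ?bad \<le> K" by simp
  have "(\<Sum>h<?e. if h \<in> ?bad then ?b h else 0) \<le> (\<Sum>h\<in>?bad. ?b h)"
    unfolding sum.inter_restrict[OF finite_lessThan, symmetric]
    by (intro sum_mono2 fin) (use p in \<open>auto simp: Bernstein_nonneg\<close>)
  also have "\<dots> \<le> (\<Sum>h\<in>?bad. ?r a)"
  proof (rule sum_mono)
    fix h assume "h \<in> ?bad"
    then have "?r (2 * h) \<le> ?r a" by (intro r) simp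
    then show "?b h \<le> ?r a"
      using Bernstein_le_sqrt[of "1 - p" "2 * h" j] p by (simp add: mult_ac)
  qed
  also have "\<dots> \<le> real K * ?r a"
    using card p by (simp add: divide_right_mono)
  finally have bad: "(\<Sum>h<?e. if h \<in> ?bad then ?b h else 0) \<le> real K * ?r a" .
  have "(real K + 1) / sqrt (p * (1 - p) * (real a + 1)) = real K * ?r a + ?r a"
    by (simp add: add_divide_distrib)
  then have "p / 4 - (real K + 1) / sqrt (p * (1 - p) * (real a + 1)) \<le>
      (\<Sum>h<?e. ?b h) - (\<Sum>h<?e. if h \<in> ?bad then ?b h else 0)"
    using sum_even_Bernstein_ge[OF p assms(3,4)] bad r[OF a] by linarith
  also have "\<dots> \<le> (\<Sum>h<?e. if x ! (2 * h) \<noteq> x ! Suc (2 * h) then ?b h else 0)"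
    unfolding sum_subtractf[symmetric] using x p
    by (intro sum_mono) (auto simp: Bernstein_nonneg not_less)
  finally show ?thesis
    unfolding coin_mass_eq using p by (intro mult_left_mono) auto
qed

lemma funpow_smooth:
  assumes "conv_op 1 D" "splits 1 w D j" "c \<le> w" "0 < c" "\<And>s. \<bar>F s\<bar> \<le> M"
  shows "\<bar>delta j ((D ^^ k) F) s\<bar> \<le> 2 * M / sqrt ((real k + 1) * c)"
proof -
  have "0 \<le> M" using assms(5)[of s] by simp
  have "\<bar>delta j ((D ^^ k) F) s\<bar> \<le> 2 * M / sqrt ((real k + 1) * w)"
    using assms by (intro splits_smooth) auto
  also have "\<dots> \<le> 2 * M / sqrt ((real k + 1) * c)"
    using assms(3,4) \<open>0 \<le> M\<close> by (intro divide_left_mono mult_pos_pos) auto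
  finally show ?thesis .
qed

lemma funpow_smooth2:
  assumes D: "conv_op 1 D" and sm: "splits 1 v D i" "splits 1 w D j" "c \<le> v" "c \<le> w" "0 < c"
    and F: "\<And>s. \<bar>F s\<bar> \<le> 1"
  shows "\<bar>delta i (delta j ((D ^^ k) F)) s\<bar> \<le> 8 / (c * (real k + 1))"
proof -
  define k1 where "k1 = k div 2"
  define k2 where "k2 = k - k1"
  have k: "k = k1 + k2" by (simp add: k1_def k2_def)
  have "delta i (delta j ((D ^^ k) F)) = delta i ((D ^^ k1) (delta j ((D ^^ k2) F)))"
    unfolding k funpow_add comp_def by (simp only: conv_op_delta[OF conv_op_funpow[OF D]])
  then have "\<bar>delta i (delta j ((D ^^ k) F)) s\<bar> = \<bar>delta i ((D ^^ k1) (delta j ((D ^^ k2) F))) s\<bar>"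
    by (simp only:)
  also have "\<dots> \<le> 2 * (2 * 1 / sqrt ((real k2 + 1) * c)) / sqrt ((real k1 + 1) * c)"
    by (rule funpow_smooth[OF D sm(1,3,5)], rule funpow_smooth[OF D sm(2,4,5)], rule F)
  also have "\<dots> = 4 / (c * sqrt ((real k1 + 1) * (real k2 + 1)))"
    using \<open>0 < c\<close> by (simp add: real_sqrt_mult)
  also have "\<dots> \<le> 4 / (c * ((real k + 1) / 2))"
  proof -
    have "k \<le> 2 * k1 + 1" "k1 \<le> k2" by (auto simp: k1_def k2_def)
    then have "real k \<le> real (2 * k1 + 1)" "real k1 \<le> real k2"
      by (simp_all only: of_nat_le_iff)
    then have "(real k + 1) / 2 \<le> real k1 + 1" "real k1 \<le> real k2" by simp_all
    then have "((real k + 1) / 2)\<^sup>2 \<le> (real k1 + 1) * (real k2 + 1)"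
      unfolding power2_eq_square by (intro mult_mono) auto
    then have "(real k + 1) / 2 \<le> sqrt ((real k1 + 1) * (real k2 + 1))"
      by (rule real_le_rsqrt)
    then show ?thesis using \<open>0 < c\<close> by (intro divide_left_mono mult_left_mono mult_pos_pos) auto
  qed
  finally show ?thesis by simp
qed

lemma trace_op_funpow_diff:
  assumes "0 < c" and even: "even a" "even L" and lm: "l * m \<le> L" "l * m + 3 ^ m < 2 * L" and "a \<le> b"
    and late: "\<And>j. j < a + 2 + 3 * L \<Longrightarrow> c \<le> coin_mass (late_string m L a b) j"
    and early: "\<And>j. j < a + 2 + 3 * L \<Longrightarrow> c \<le> coin_mass (early_string m L a b) j"
    and F: "\<And>s. \<bar>F s\<bar> \<le> 1"
  shows "\<bar>(trace_op (late_string m L a b) 0 ^^ T) F s - (trace_op (early_string m L a b) 0 ^^ T) F s\<bar>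
    \<le> 4 * real T * (\<Prod>k<m. 2 * 3 ^ k * sqrt ((1 - p) / (p * (real l + 1))))
      + 128 * (real (3 * L))\<^sup>2 / (c * p * sqrt (real a + 1))"
proof (cases "T = 0")
  case True
  have "0 \<le> (128 * (real (3 * L))\<^sup>2 / (c * p * sqrt (real a + 1)) :: real)"
    using assms(1) p by (intro divide_nonneg_nonneg mult_nonneg_nonneg) auto
  then show ?thesis using True by simp
next
  case False
  define D where "D = trace_op (late_string m L a b) 0"
  define E where "E = trace_op (early_string m L a b) 0"
  define P where "P = (\<Prod>k<m. 2 * 3 ^ k * sqrt ((1 - p) / (p * (real l + 1))))"
  have conv: "conv_op 1 D" "conv_op 1 E" by (simp_all add: D_def E_def conv_op_trace_op)
  have split: "splits 1 (coin_mass (late_string m L a b) j) D j"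
    "splits 1 (coin_mass (early_string m L a b) j) E j" for j
    using splits_trace_op[of _ j 0] by (simp_all add: D_def E_def)
  have bdd: "bounded_op 1 (D ^^ k)" "bounded_op 1 (E ^^ k)" for k
    using conv by (auto intro: bounded_op_funpow conv_op_bounded)
  have DE: "(D ^^ i) ((E ^^ k) G) = (E ^^ k) ((D ^^ i) G)" for i k G
    by (rule funpow_commute) (simp add: D_def E_def trace_op_commute)
  define G where "G k = (E ^^ (T - k)) ((D ^^ k) F)" for k
  define F' where "F' k = (E ^^ (T - 1 - k)) ((D ^^ k) F)" for k
  let ?B = "16 / (c * real T)"
  have step: "\<bar>G (Suc k) s - G k s\<bar> \<le> 4 * P + 8 * (real (3 * L))\<^sup>2 * ?B / (p * sqrt (real a + 1))" if k: "k < T" for k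
  proof -
    have "G (Suc k) = D (F' k)"
      using k DE[of 1 "T - Suc k" "(D ^^ k) F"] by (simp add: G_def F'_def)
    moreover have "T - k = Suc (T - 1 - k)" using k by simp
    then have "G k = E (F' k)"
      by (simp add: G_def F'_def)
    moreover have "\<bar>D (F' k) s - E (F' k) s\<bar> \<le> 4 * P + 8 * (real (3 * L))\<^sup>2 * ?B / (p * sqrt (real a + 1))"
      unfolding D_def E_def P_def
    proof (rule trace_op_strings_diff[OF even lm \<open>a \<le> b\<close>])
      show "\<bar>F' k s\<bar> \<le> 1" for s
        unfolding F'_def by (intro bounded_op_le1[OF bdd(2)] bounded_op_le1[OF bdd(1)] F)
      show "0 \<le> ?B" using \<open>0 < c\<close> by simp
      fix i j s assume "i < j" "j < a + 2 + 3 * L"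
      then have i: "i < a + 2 + 3 * L" and j: "j < a + 2 + 3 * L" by auto
      have B: "8 / (c * (real k' + 1)) \<le> ?B" if "T \<le> 2 * (k' + 1)" for k'
      proof -
        have "real T \<le> real (2 * (k' + 1))" using that by (simp only: of_nat_le_iff)
        then have "8 / (c * (real k' + 1)) \<le> 8 / (c * (real T / 2))"
          using \<open>0 < c\<close> False by (intro divide_left_mono mult_left_mono mult_pos_pos) auto
        then show ?thesis by simp
      qed
      show "\<bar>delta i (delta j (F' k)) s\<bar> \<le> ?B"
      proof (cases "T \<le> 2 * (k + 1)")
        case True
        have "delta i (delta j (F' k)) = (E ^^ (T - 1 - k)) (delta i (delta j ((D ^^ k) F)))"
          unfolding F'_def by (simp only: conv_op_delta[OF conv_op_funpow[OF conv(2)]])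
        moreover have "\<bar>(E ^^ (T - 1 - k)) (delta i (delta j ((D ^^ k) F))) s\<bar> \<le> ?B"
          by (intro bounded_op_le1[OF bdd(2)] order_trans[OF funpow_smooth2[where c = c, OF conv(1) split(1) split(1)]]
              late i j F \<open>0 < c\<close> B True)
        ultimately show ?thesis by (simp only:)
      next
        case False
        then have *: "T \<le> 2 * (T - 1 - k + 1)" using k by simp
        have "F' k = (D ^^ k) ((E ^^ (T - 1 - k)) F)"
          unfolding F'_def by (rule DE[symmetric])
        then have "delta i (delta j (F' k)) = (D ^^ k) (delta i (delta j ((E ^^ (T - 1 - k)) F)))"
          by (simp only: conv_op_delta[OF conv_op_funpow[OF conv(1)]])
        moreover have "\<bar>(D ^^ k) (delta i (delta j ((E ^^ (T - 1 - k)) F))) s\<bar> \<le> ?B"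
          by (intro bounded_op_le1[OF bdd(1)] order_trans[OF funpow_smooth2[where c = c, OF conv(2) split(2) split(2)]]
              early i j F \<open>0 < c\<close> B *)
        ultimately show ?thesis by (simp only:)
      qed
    qed
    ultimately show ?thesis by simp
  qed
  have "(D ^^ T) F s - (E ^^ T) F s = (\<Sum>k<T. G (Suc k) s - G k s)"
    using sum_lessThan_telescope[of "\<lambda>k. G k s" T] by (simp add: G_def)
  also have "\<bar>\<dots>\<bar> \<le> (\<Sum>k<T. 4 * P + 8 * (real (3 * L))\<^sup>2 * ?B / (p * sqrt (real a + 1)))"
    by (rule order_trans[OF sum_abs]) (intro sum_mono step, simp)
  also have "\<dots> = 4 * real T * P + 128 * (real (3 * L))\<^sup>2 / (c * p * sqrt (real a + 1))"
    using False by (simp add: distrib_left)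
  finally show ?thesis unfolding D_def E_def P_def .
qed

end

section \<open>Reduction to test functions\<close>

context deletion_channel
begin

lemma expectation_replicate_pmf:
  "measure_pmf.expectation (replicate_pmf T (trace_pmf p x)) (\<lambda>S. F (fold (\<lambda>t. add_bits t 0) S s)) =
     (trace_op x 0 ^^ T) F s"
proof (induction T arbitrary: s)
  case (Suc T)
  let ?D = "trace_pmf p x" and ?V = "fold (\<lambda>t. add_bits t 0)"
  have fin: "finite (set_pmf (trace_pmf p y))" for y
    by (induction y) auto
  have fin': "finite (set_pmf (replicate_pmf T ?D))"
    using finite_lists_length_eq[OF fin[of x], of T] by (auto simp: set_replicate_pmf lists_eq_set elim: finite_subset[rotated])
  have "replicate_pmf (Suc T) ?D = ?D \<bind> (\<lambda>t. map_pmf ((#) t) (replicate_pmf T ?D))"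
    by (simp add: map_pmf_def)
  then have "measure_pmf.expectation (replicate_pmf (Suc T) ?D) (\<lambda>S. F (?V S s)) =
      (\<Sum>t\<in>set_pmf ?D. pmf ?D t *\<^sub>R (trace_op x 0 ^^ T) F (add_bits t 0 s))"
    using fin[of x] fin' by (simp add: pmf_expectation_bind[OF _ _ order_refl] Suc)
  also have "\<dots> = measure_pmf.expectation ?D (\<lambda>t. (trace_op x 0 ^^ T) F (add_bits t 0 s))"
    using fin[of x] by (intro integral_measure_pmf[symmetric]) auto
  also have "\<dots> = (trace_op x 0 ^^ Suc T) F s"
    by (simp add: expectation_trace_pmf trace_op_def)
  finally show ?case .
qed simp

lemma fold_add_bits_apply:
  "real (fold (\<lambda>t. add_bits t 0) S s j) = real (s j) + (\<Sum>t\<leftarrow>S. trace_bit t j)"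
  by (induction S arbitrary: s) (auto simp: add_bits_apply trace_bit_def)

lemma mean_based_factors:
  assumes "mean_based A" "length x = length y"
  obtains F where "\<And>v. \<bar>F v\<bar> \<le> 1"
    "\<And>S. length S = T \<Longrightarrow> pmf (A x y S) z = F (fold (\<lambda>t. add_bits t 0) S (\<lambda>_. 0))"
proof
  let ?V = "\<lambda>S. fold (\<lambda>t. add_bits t 0) S (\<lambda>_. 0)"
  define F where "F v = pmf (A x y (SOME S. length S = T \<and> ?V S = v)) z" for v
  show "\<bar>F v\<bar> \<le> 1" for v by (simp add: F_def pmf_le_1)
  fix S :: "bits list" assume S: "length S = T"
  let ?S' = "SOME S'. length S' = T \<and> ?V S' = ?V S"
  have S': "length ?S' = T \<and> ?V ?S' = ?V S"
    by (rule someI[of _ S]) (simp add: S)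
  have "empirical_mean S j = empirical_mean ?S' j" for j
  proof -
    have "(\<Sum>t\<leftarrow>S. trace_bit t j) = (\<Sum>t\<leftarrow>?S'. trace_bit t j)"
      using fold_add_bits_apply[of S "\<lambda>_. 0" j] fold_add_bits_apply[of ?S' "\<lambda>_. 0" j] S' by simp
    then show ?thesis using S S' by (simp add: empirical_mean_def)
  qed
  then have "empirical_means (length x) S = empirical_means (length x) ?S'"
    by (simp add: empirical_means_def)
  then have "A x y S = A x y ?S'"
    using assms unfolding mean_based_def by blast
  then show "pmf (A x y S) z = F (?V S)" by (simp add: F_def)
qed

lemma distinguishes_imp:
  assumes A: "mean_based A" "distinguishes p A T x y" and xy: "x \<noteq> y" "length x = length y"
    and bound: "\<And>F :: vec \<Rightarrow> real. (\<And>v. \<bar>F v\<bar> \<le> 1) \<Longrightarrow>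
      \<bar>(trace_op x 0 ^^ T) F (\<lambda>_. 0) - (trace_op y 0 ^^ T) F (\<lambda>_. 0)\<bar> \<le> e"
  shows "1 / 3 \<le> e"
proof -
  obtain F where F: "\<And>v. \<bar>F v\<bar> \<le> 1"
    "\<And>S. length S = T \<Longrightarrow> pmf (A x y S) x = F (fold (\<lambda>t. add_bits t 0) S (\<lambda>_. 0))"
    using mean_based_factors[OF A(1) xy(2)] by metis
  define M where "M src = replicate_pmf T (trace_pmf p src) \<bind> A x y" for src
  have M: "pmf (M src) x = (trace_op src 0 ^^ T) F (\<lambda>_. 0)" for src
    unfolding M_def pmf_bind expectation_replicate_pmf[symmetric]
    by (intro integral_cong_AE) (auto simp: AE_measure_pmf_iff set_replicate_pmf F(2))
  have "pmf (M y) x + pmf (M y) y = measure (measure_pmf (M y)) {x, y}"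
    using xy(1) by (simp add: measure_measure_pmf_finite)
  also have "\<dots> \<le> 1" by simp
  finally have "pmf (M y) x \<le> 1 - pmf (M y) y" by simp
  moreover have "2 / 3 \<le> pmf (M x) x" "2 / 3 \<le> pmf (M y) y"
    using A(2) by (simp_all add: distinguishes_def success_prob_def M_def)
  ultimately have "1 / 3 \<le> \<bar>pmf (M x) x - pmf (M y) x\<bar>" by linarith
  also have "\<dots> \<le> e" unfolding M by (rule bound[OF F(1)])
  finally show ?thesis .
qed

lemma coin_mass_strings_ge:
  assumes even: "even a" "even L" and j: "j < a + 2 + 3 * L"
    and n: "n = a + 2 + 3 * L + b"
    and big: "9 \<le> real n * (1 - p)" "2 * (real a + 2 + 3 * real L) + 1 \<le> real n * (1 - p)"
    and small: "(3 * real L + 3) / sqrt (p * (1 - p) * (real a + 1)) \<le> p / 8"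
    and x: "x = late_string m L a b \<or> x = early_string m L a b"
  shows "p\<^sup>2 * (1 - p) / 4 \<le> coin_mass x j"
proof -
  have len: "length x = n" using x n by auto
  have "real n \<le> 2 * real (n div 2) + 1"
  proof -
    have "n \<le> 2 * (n div 2) + 1" by linarith
    then have "real n \<le> real (2 * (n div 2) + 1)" by (simp only: of_nat_le_iff)
    then show ?thesis by simp
  qed
  then have "real n * (1 - p) \<le> (2 * real (n div 2) + 1) * (1 - p)"
    using p by (intro mult_right_mono) auto
  then have e: "real n * (1 - p) - 1 \<le> real (2 * (n div 2)) * (1 - p)"
    using p by (simp add: algebra_simps)
  have 1: "2 * p * (1 - p) * (p / 4 - (real (2 + 3 * L) + 1) / sqrt (p * (1 - p) * (real a + 1))) \<le> coin_mass x j"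
  proof (rule coin_mass_ge; (unfold len)?)
    show "8 \<le> real (2 * (n div 2)) * (1 - p)" using e big(1) by linarith
    have "real j \<le> real a + 2 + 3 * real L" using j by simp
    then have "2 * real j \<le> real n * (1 - p) - 1" using big(2) by argo
    also note e
    finally show "2 * real j \<le> real (2 * (n div 2)) * (1 - p)" .
    show "a \<le> 2 * (n div 2)" using n even by linarith
    fix h assume h: "h < n div 2" "2 * h < a \<or> a + (2 + 3 * L) \<le> 2 * h"
    have "2 * h + 1 < n" using h(1) by linarith
    then show "x ! (2 * h) \<noteq> x ! Suc (2 * h)"
      using x alternating_append_alternates[of "a + 2" "pattern m L" h b]
        alternating_append_alternates[of a "pattern m L" h "b + 2"] even h(2) n
      by (auto simp: late_string_def early_string_def)
  qed
  have "p\<^sup>2 * (1 - p) / 4 = 2 * p * (1 - p) * (p / 4 - p / 8)"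
    by (simp add: power2_eq_square)
  also have "\<dots> \<le> 2 * p * (1 - p) * (p / 4 - (real (2 + 3 * L) + 1) / sqrt (p * (1 - p) * (real a + 1)))"
    using small p by (intro mult_left_mono diff_mono) (auto simp: algebra_simps)
  also note 1
  finally show ?thesis .
qed

end

section \<open>Choice of parameters\<close>

lemma prod_thue_factors_le:
  assumes "0 \<le> C" "2 * C * (9 / 10) ^ m \<le> 1"
  shows "(\<Prod>k<m. 2 * 3 ^ k * (C / sqrt (real (100 ^ m) + 1))) \<le> exp (- (real m)\<^sup>2)"
proof -
  have "((10 :: real) ^ m)\<^sup>2 = (10\<^sup>2) ^ m" by (simp only: power_mult[symmetric] mult.commute)
  then have "(10 :: real) ^ m = sqrt (real (100 ^ m))"
    by (intro real_sqrt_unique[symmetric]) simp_all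
  also have "\<dots> \<le> sqrt (real (100 ^ m) + 1)" by simp
  finally have ten: "(10 :: real) ^ m \<le> sqrt (real (100 ^ m) + 1)" .
  have "2 * 3 ^ k * (C / sqrt (real (100 ^ m) + 1)) \<le> exp (- real m)" if "k < m" for k
  proof -
    have "2 * 3 ^ k * (C / sqrt (real (100 ^ m) + 1)) \<le> 2 * 3 ^ m * (C / 10 ^ m)"
      using that assms(1) ten by (intro mult_mono frac_le power_increasing) auto
    also have "\<dots> = (2 * C * (9 / 10) ^ m) * (1 / 3 ^ m)"
    proof -
      have "(9 / 10 :: real) ^ m = 3 ^ m * 3 ^ m / 10 ^ m"
        by (simp add: power_divide flip: power_mult_distrib)
      then show ?thesis by simp
    qed
    also have "\<dots> \<le> 1 * (1 / 3 ^ m)"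
      using assms(2) by (intro mult_right_mono) auto
    also have "\<dots> \<le> exp (- real m)"
    proof -
      have "exp (real m) = exp 1 ^ m" by (simp flip: exp_of_nat_mult)
      also have "\<dots> \<le> 3 ^ m" by (intro power_mono exp_le) simp
      finally show ?thesis by (simp add: exp_minus divide_simps)
    qed
    finally show ?thesis .
  qed
  then have "(\<Prod>k<m. 2 * 3 ^ k * (C / sqrt (real (100 ^ m) + 1))) \<le> (\<Prod>k<m. exp (- real m))"
    using assms(1) by (intro prod_mono) auto
  also have "\<dots> = exp (- (real m)\<^sup>2)"
    by (simp add: power2_eq_square flip: exp_of_nat_mult)
  finally show ?thesis .
qed

lemma hundred_power_le:
  assumes "0 < x" "real m \<le> ln x / 100"
  shows "(100 :: real) ^ m \<le> x powr (7 / 100)"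
proof -
  have "(2 :: real) \<le> exp 1" using exp_ge_add_one_self[of 1] by simp
  then have "(2 :: real) ^ 7 \<le> exp 1 ^ 7" by (intro power_mono) auto
  then have "100 \<le> exp (7 :: real)" by (simp flip: exp_of_nat_mult)
  then have "(100 :: real) ^ m \<le> exp 7 ^ m" by (intro power_mono) auto
  also have "\<dots> = exp (7 * real m)" by (simp add: mult.commute flip: exp_of_nat_mult)
  also have "\<dots> \<le> exp (7 / 100 * ln x)" using assms(2) by simp
  also have "\<dots> = x powr (7 / 100)" using assms(1) by (simp add: powr_def)
  finally show ?thesis .
qed

context deletion_channel
begin

lemma hard_strings:
  fixes a b m n :: nat
  defines "L \<equiv> 2 * m * 100 ^ m"
  assumes "1 \<le> m" and a: "even a" "a \<le> b" and n: "n = a + 2 + 3 * L + b"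
    and big: "9 \<le> real n * (1 - p)" "2 * (real a + 2 + 3 * real L) + 1 \<le> real n * (1 - p)"
    and small: "(3 * real L + 3) / sqrt (p * (1 - p) * (real a + 1)) \<le> p / 8"
      "128 * (real (3 * L))\<^sup>2 / (p\<^sup>2 * (1 - p) / 4 * p * sqrt (real a + 1)) < 1 / 6"
      "2 * sqrt ((1 - p) / p) * (9 / 10) ^ m \<le> 1"
  obtains x y :: bits where "length x = n" "length y = n" "x \<noteq> y" "edit_distance x y \<le> 4"
    "\<And>A T. mean_based A \<Longrightarrow> distinguishes p A T x y \<Longrightarrow> exp ((real m)\<^sup>2) \<le> 24 * real T"
proof
  let ?x = "late_string m L a b" and ?y = "early_string m L a b"
  have L: "even L" "2 \<le> L" "100 ^ m * m \<le> L" "100 ^ m * m + 3 ^ m < 2 * L"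
  proof -
    show "even L" "2 \<le> L" "100 ^ m * m \<le> L" using \<open>1 \<le> m\<close> by (auto simp: L_def)
    have "(3 :: nat) ^ m \<le> 100 ^ m" by (intro power_mono) auto
    also have "\<dots> \<le> 100 ^ m * m" using \<open>1 \<le> m\<close> by simp
    moreover have "0 < 100 ^ m * m" using \<open>1 \<le> m\<close> by simp
    moreover have "L = 2 * (100 ^ m * m)" by (simp add: L_def)
    ultimately show "100 ^ m * m + 3 ^ m < 2 * L" by linarith
  qed
  show len: "length ?x = n" "length ?y = n" using n by simp_all
  show ne: "?x \<noteq> ?y" by (rule late_string_neq_early_string[OF a(1) L(1,2)])
  show "edit_distance ?x ?y \<le> 4" by (rule edit_distance_strings[OF a(1)])
  fix A T assume A: "mean_based A" "distinguishes p A T ?x ?y"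
  let ?c = "p\<^sup>2 * (1 - p) / 4"
  have "1 / 3 \<le> 4 * real T * (\<Prod>k<m. 2 * 3 ^ k * sqrt ((1 - p) / (p * (real (100 ^ m) + 1))))
      + 128 * (real (3 * L))\<^sup>2 / (?c * p * sqrt (real a + 1))"
  proof (rule distinguishes_imp[OF A ne])
    show "length ?x = length ?y" by simp
    fix F :: "vec \<Rightarrow> real" assume "\<And>v. \<bar>F v\<bar> \<le> 1"
    then show "\<bar>(trace_op ?x 0 ^^ T) F (\<lambda>_. 0) - (trace_op ?y 0 ^^ T) F (\<lambda>_. 0)\<bar> \<le>
        4 * real T * (\<Prod>k<m. 2 * 3 ^ k * sqrt ((1 - p) / (p * (real (100 ^ m) + 1))))
        + 128 * (real (3 * L))\<^sup>2 / (?c * p * sqrt (real a + 1))"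
      using p by (intro trace_op_funpow_diff a L coin_mass_strings_ge[OF a(1) L(1) _ n big small(1)]) auto
  qed
  moreover have "(\<Prod>k<m. 2 * 3 ^ k * sqrt ((1 - p) / (p * (real (100 ^ m) + 1)))) \<le> exp (- (real m)\<^sup>2)"
    using prod_thue_factors_le[of "sqrt ((1 - p) / p)" m] small(3) p
    by (simp add: real_sqrt_divide real_sqrt_mult)
  then have "4 * real T * (\<Prod>k<m. 2 * 3 ^ k * sqrt ((1 - p) / (p * (real (100 ^ m) + 1))))
      \<le> 4 * real T * exp (- (real m)\<^sup>2)"
    by (intro mult_left_mono) auto
  ultimately have "1 / 6 \<le> 4 * real T * exp (- (real m)\<^sup>2)"
    using small(2) by linarith
  then show "exp ((real m)\<^sup>2) \<le> 24 * real T"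
    by (simp add: exp_minus field_simps)
qed

lemma eventually_hard_strings:
  "\<forall>\<^sub>F n in sequentially. \<exists>x y :: bits. length x = n \<and> length y = n \<and> x \<noteq> y \<and> edit_distance x y \<le> 4 \<and>
     (\<forall>A T. mean_based A \<and> distinguishes p A T x y \<longrightarrow> real T \<ge> exp (1 / 80000 * (ln (real n))\<^sup>2))"
proof -
  define q where "q = 1 - p"
  have q: "0 < q" "q < 1" using p by (auto simp: q_def)
  define K where "K n = 2 * ln (real n) * real n powr (7 / 100)" for n
  have lim: "(\<lambda>n. (3 * K n + 3) / sqrt (real n)) \<longlonglongrightarrow> 0" "(\<lambda>n. (K n)\<^sup>2 / sqrt (real n)) \<longlonglongrightarrow> 0"
    "(\<lambda>n. (6 * K n + 8) / real n) \<longlonglongrightarrow> 0" "(\<lambda>k. (9 / 10 :: real) ^ k) \<longlonglongrightarrow> 0"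
    unfolding K_def by real_asymp+
  define e1 where "e1 = p / 8 * (q * sqrt p / 4)"
  define e2 where "e2 = p\<^sup>2 * q / 4 * p * (sqrt q / 4) / (7 * 128 * 9)"
  have e: "0 < e1" "0 < e2" using p q by (auto simp: e1_def e2_def)
  obtain m0 where m0: "\<And>m. m0 \<le> m \<Longrightarrow> (9 / 10) ^ m < 1 / (2 * sqrt (q / p))"
    using order_tendstoD(2)[OF lim(4), of "1 / (2 * sqrt (q / p))"] p q
    by (auto simp: eventually_sequentially)
  have ev: "\<forall>\<^sub>F n in sequentially. (3 * K n + 3) / sqrt (real n) < e1"
    "\<forall>\<^sub>F n in sequentially. (K n)\<^sup>2 / sqrt (real n) < e2"
    "\<forall>\<^sub>F n in sequentially. (6 * K n + 8) / real n < q / 2"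
    using order_tendstoD(2)[OF lim(1) e(1)] order_tendstoD(2)[OF lim(2) e(2)]
      order_tendstoD(2)[OF lim(3), of "q / 2"] q by simp_all
  have ln_top: "filterlim (\<lambda>n. ln (real n)) at_top sequentially" by real_asymp
  have ev_n: "\<forall>\<^sub>F n in sequentially. 64 / q \<le> real n"
    using filterlim_real_sequentially unfolding filterlim_at_top by blast
  have ev_ln: "\<forall>\<^sub>F n in sequentially. max 2000 (200 * real m0 + 200) \<le> ln (real n)"
    using ln_top unfolding filterlim_at_top by blast
  show ?thesis
    using ev ev_n ev_ln eventually_gt_at_top[of 1]
  proof eventually_elim
    case (elim n)
    define z where "z = ln (real n)"
    have z: "2000 \<le> z" "200 * real m0 + 200 \<le> z" using elim(5) by (auto simp: z_def)
    define m where "m = nat \<lfloor>z / 100\<rfloor>"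
    have m: "real m \<le> z / 100" "z / 100 < real m + 1"
    proof -
      have "0 \<le> z / 100" using z by simp
      then show "real m \<le> z / 100" "z / 100 < real m + 1" unfolding m_def by linarith+
    qed
    define L where "L = 2 * m * 100 ^ m"
    have n: "0 < real n" "64 \<le> q * real n" using elim(4,6) q by (auto simp: field_simps)
    have LK: "real L \<le> K n"
    proof -
      have "real L = 2 * real m * 100 ^ m" by (simp add: L_def)
      also have "\<dots> \<le> 2 * z * real n powr (7 / 100)"
        using m z n hundred_power_le[of "real n" m] by (intro mult_mono) (auto simp: z_def)
      finally show ?thesis by (simp add: K_def z_def)
    qed
    have K0: "0 \<le> K n" using LK by linarith
    define f where "f = nat \<lfloor>q * real n / 16\<rfloor>"
    define a where "a = 2 * f"
    have f: "real f \<le> q * real n / 16" "q * real n / 16 < real f + 1"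
    proof -
      have "0 \<le> q * real n / 16" using n by simp
      then show "real f \<le> q * real n / 16" "q * real n / 16 < real f + 1"
        unfolding f_def by linarith+
    qed
    then have a: "real a \<le> q * real n / 8" "q * real n / 16 \<le> real a + 1"
      by (simp_all add: a_def)
    have qn: "q * real n \<le> real n" using q n by simp
    have K3: "6 * K n + 8 < q * real n / 2"
      using elim(3) n(1) by (simp add: field_simps)
    have "real (2 * a + 2 + 3 * L) \<le> real n"
      using a(1) K3 LK qn K0 by simp
    then have "2 * a + 2 + 3 * L \<le> n" by (simp only: of_nat_le_iff)
    then obtain b where b: "n = a + 2 + 3 * L + b" "a \<le> b"
      using that[of "n - (a + 2 + 3 * L)"] by auto
    have sn: "0 < sqrt (real n)" using n by simp
    have sa: "q * sqrt p / 4 * sqrt (real n) \<le> sqrt (p * q * (real a + 1))"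
      "sqrt q / 4 * sqrt (real n) \<le> sqrt (real a + 1)"
    proof -
      have "sqrt (q * real n / 16) \<le> sqrt (real a + 1)" using a(2) by simp
      then show 1: "sqrt q / 4 * sqrt (real n) \<le> sqrt (real a + 1)"
        by (simp add: real_sqrt_mult real_sqrt_divide)
      have "sqrt (p * q) * (sqrt q / 4 * sqrt (real n)) \<le> sqrt (p * q) * sqrt (real a + 1)"
        using 1 p q by (intro mult_left_mono) auto
      moreover have "sqrt (p * q) * (sqrt q / 4 * sqrt (real n)) = q * sqrt p / 4 * sqrt (real n)"
        using q by (simp add: real_sqrt_mult)
      ultimately show "q * sqrt p / 4 * sqrt (real n) \<le> sqrt (p * q * (real a + 1))"
        by (simp only: real_sqrt_mult)
    qed
    have "1 \<le> m" "m0 \<le> m"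
    proof -
      have "real m0 < real m" "1 < real m" using m z by linarith+
      then show "1 \<le> m" "m0 \<le> m" by simp_all
    qed
    obtain x y where xy: "length x = n" "length y = n" "x \<noteq> y" "edit_distance x y \<le> 4"
      "\<And>A T. mean_based A \<Longrightarrow> distinguishes p A T x y \<Longrightarrow> exp ((real m)\<^sup>2) \<le> 24 * real T"
    proof (rule hard_strings[OF \<open>1 \<le> m\<close> _ b(2), folded L_def, OF _ b(1), folded q_def])
      show "even a" by (simp add: a_def)
      show "9 \<le> real n * q" using n by (simp add: mult.commute)
      show "2 * (real a + 2 + 3 * real L) + 1 \<le> real n * q"
        using a(1) K3 LK n by (simp add: mult.commute)
      have "3 * real L + 3 \<le> e1 * sqrt (real n)"
        using elim(1) sn LK by (simp add: field_simps)
      also have "\<dots> = p / 8 * (q * sqrt p / 4 * sqrt (real n))" by (simp add: e1_def)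
      also have "\<dots> \<le> p / 8 * sqrt (p * q * (real a + 1))"
        using sa(1) p by (intro mult_left_mono) auto
      finally show "(3 * real L + 3) / sqrt (p * q * (real a + 1)) \<le> p / 8"
        using p q by (simp add: pos_divide_le_eq)
      have "(real L)\<^sup>2 \<le> (K n)\<^sup>2" using LK by (intro power_mono) auto
      also have "\<dots> \<le> e2 * sqrt (real n)"
        using elim(2) sn by (simp add: field_simps)
      also have "\<dots> = p\<^sup>2 * q / 4 * p / (7 * 128 * 9) * (sqrt q / 4 * sqrt (real n))" by (simp add: e2_def)
      also have "\<dots> \<le> p\<^sup>2 * q / 4 * p / (7 * 128 * 9) * sqrt (real a + 1)"
        using sa(2) p q by (intro mult_left_mono) auto
      finally have "128 * (real (3 * L))\<^sup>2 \<le> 1 / 7 * (p\<^sup>2 * q / 4 * p * sqrt (real a + 1))"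
        by (simp add: power_mult_distrib)
      also have "\<dots> < 1 / 6 * (p\<^sup>2 * q / 4 * p * sqrt (real a + 1))"
        using p q by (intro mult_strict_right_mono mult_pos_pos) auto
      finally show "128 * (real (3 * L))\<^sup>2 / (p\<^sup>2 * q / 4 * p * sqrt (real a + 1)) < 1 / 6"
        using p q by (subst pos_divide_less_eq) (auto intro!: mult_pos_pos)
      show "2 * sqrt (q / p) * (9 / 10) ^ m \<le> 1"
        using m0[OF \<open>m0 \<le> m\<close>] p q by (simp add: field_simps)
    qed blast
    have "exp (1 / 80000 * z\<^sup>2) \<le> real T" if "mean_based A" "distinguishes p A T x y" for A T
    proof -
      have "z / 200 \<le> real m" using m z by linarith
      then have "(z / 200)\<^sup>2 \<le> (real m)\<^sup>2" using z by (intro power_mono) auto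
      moreover have "(2000 :: real)\<^sup>2 \<le> z\<^sup>2" using z by (intro power_mono) auto
      ultimately have "exp 23 * exp (1 / 80000 * z\<^sup>2) \<le> exp ((real m)\<^sup>2)"
        by (simp add: power_divide flip: exp_add)
      also have "\<dots> \<le> 24 * real T" by (rule xy(5)[OF that])
      finally have "exp 23 * exp (1 / 80000 * z\<^sup>2) \<le> 24 * real T" .
      moreover have "24 * exp (1 / 80000 * z\<^sup>2) \<le> exp 23 * exp (1 / 80000 * z\<^sup>2)"
        using exp_ge_add_one_self[of 23] by (intro mult_right_mono) auto
      ultimately show ?thesis by linarith
    qed
    then show ?case
      using xy(1-4) unfolding z_def by blast
  qed
qed

end

theorem theorem2:
  fixes p :: real
  assumes "0 < p" and "p < 1"
  shows "\<exists>c>0. \<forall>\<^sub>F n in sequentially.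
           \<exists>x y :: bits. length x = n \<and> length y = n \<and> x \<noteq> y \<and> edit_distance x y \<le> 4 \<and>
             (\<forall>A T. mean_based A \<and> distinguishes p A T x y \<longrightarrow>
                real T \<ge> exp (c * (ln (real n))\<^sup>2))"
proof -
  interpret deletion_channel p by standard (use assms in auto)
  show ?thesis
    by (rule exI[of _ "1 / 80000"]) (simp only: eventually_hard_strings, simp)
qed

end
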